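(* Let $\kappa>0$ and $\tau>0$ with $\kappa\ne\tau^2$. The Berger sphere $S^3(\kappa,\tau)$ does not admit any isotropic geodesic.
   Context: $S^3(\kappa,\tau)$ is the connected, simply connected 3-dimensional Lie group whose Lie algebra has a basis $\{u_1,u_2,u_3\}$ with $[u_1,u_2]=\tau u_3$, $[u_2,u_3]=\frac{\kappa}{\tau}u_1$, $[u_3,u_1]=\frac{\kappa}{\tau}u_2$ (where $\kappa>0$), equipped with the left-invariant Riemannian metric for which $\{u_1,u_2,u_3\}$ is orthonormal. A Jacobi field along a geodesic $\gamma$ is isotropic if it is the restriction to $\gamma$ of a Killing vector field. A point $\gamma(t)$ conjugate to $p=\gamma(0)$ along $\gamma$ is isotropic if some nonzero isotropic Jacobi field along $\gamma$ vanishes at $0$ and $t$. A geodesic $\gamma$ (defined on $\mathbb R$, non-constant) starting at $p$ is isotropic if every conjugate point to $p$ along $\gamma$ is isotropic (in particular this holds if there are no conjugate points). *)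

theory Defs
  imports "HOL-Analysis.Analysis"
begin

section \<open>Smooth maps between normed spaces\<close>

primrec Ck_on :: "nat \<Rightarrow> 'a::real_normed_vector set \<Rightarrow> ('a \<Rightarrow> 'b::real_normed_vector) \<Rightarrow> bool" where
  "Ck_on 0 S f \<longleftrightarrow> continuous_on S f"
| "Ck_on (Suc n) S f \<longleftrightarrow>
     f differentiable_on S \<and> (\<forall>v. Ck_on n S (\<lambda>x. frechet_derivative f (at x) v))"

text \<open>Used for open \<open>S\<close> in finite-dimensional spaces only.\<close>

definition smooth_on :: "'a::real_normed_vector set \<Rightarrow> ('a \<Rightarrow> 'b::real_normed_vector) \<Rightarrow> bool" where
  "smooth_on S f \<longleftrightarrow> (\<forall>n. Ck_on n S f)"

section \<open>The Lie group of unit quaternions\<close>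

text \<open>
  The connected, simply connected Lie group with the Lie algebra in question is realised as
  the group of unit quaternions.  The pair \<open>(z, w)\<close> stands for the quaternion \<open>z + w j\<close>, so
  \<open>1 = (1, 0)\<close>, \<open>i = (\<i>, 0)\<close>, \<open>j = (0, 1)\<close>, \<open>k = (0, \<i>)\<close>.  The product type carries the
  Euclidean structure of \<open>\<real>\<^sup>4\<close>.
\<close>

type_synonym quat = "complex \<times> complex"

definition qmult :: "quat \<Rightarrow> quat \<Rightarrow> quat" (infixl "\<odot>" 70) where
  "p \<odot> q = (fst p * fst q - snd p * cnj (snd q), fst p * snd q + snd p * cnj (fst q))"

definition qone :: quat where
  "qone = (1, 0)"

definition qconj :: "quat \<Rightarrow> quat" where
  "qconj p = (cnj (fst p), - snd p)"

abbreviation S3 :: "quat set" where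
  "S3 \<equiv> sphere 0 1"

definition tangent :: "quat \<Rightarrow> quat set" where
  "tangent x = {v. v \<bullet> x = 0}"

text \<open>
  A map \<open>f\<close> on the sphere is differentiated through \<open>f \<circ> sgn\<close>, where \<open>sgn x = x /\<^sub>R norm x\<close> is
  the smooth retraction of the punctured space onto the sphere.  So \<open>f\<close> is smooth as a map on the
  manifold \<open>S3\<close> iff \<open>f \<circ> sgn\<close> is smooth off the origin, and for \<open>v \<in> tangent x\<close> the
  derivative of \<open>f\<close> in the direction \<open>v\<close> is that of \<open>f \<circ> sgn\<close>.  Values of \<open>f\<close> off \<open>S3\<close>
  play no role.
\<close>

definition smooth_S3 :: "(quat \<Rightarrow> 'b::real_normed_vector) \<Rightarrow> bool" where
  "smooth_S3 f \<longleftrightarrow> smooth_on (- {0}) (f \<circ> sgn)"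

definition dir_deriv :: "(quat \<Rightarrow> 'b::real_normed_vector) \<Rightarrow> quat \<Rightarrow> quat \<Rightarrow> 'b" where
  "dir_deriv f x v = frechet_derivative (f \<circ> sgn) (at x) v"

definition vector_field :: "(quat \<Rightarrow> quat) \<Rightarrow> bool" where
  "vector_field X \<longleftrightarrow> smooth_S3 X \<and> (\<forall>x\<in>S3. X x \<in> tangent x)"

definition vf_bracket :: "(quat \<Rightarrow> quat) \<Rightarrow> (quat \<Rightarrow> quat) \<Rightarrow> quat \<Rightarrow> quat" where
  "vf_bracket X Y = (\<lambda>x. dir_deriv Y x (X x) - dir_deriv X x (Y x))"

text \<open>The Lie algebra is \<open>tangent qone\<close>; \<open>linv \<xi>\<close> is the left-invariant field with value \<open>\<xi>\<close> at \<open>qone\<close>.\<close>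

definition linv :: "quat \<Rightarrow> quat \<Rightarrow> quat" where
  "linv \<xi> = (\<lambda>x. x \<odot> \<xi>)"

section \<open>The Berger metric\<close>

text \<open>
  The basis of the Lie algebra is \<open>u\<^sub>1 = (\<surd>\<kappa>/2) j\<close>, \<open>u\<^sub>2 = (\<surd>\<kappa>/2) k\<close>, \<open>u\<^sub>3 = (\<kappa>/(2\<tau>)) i\<close>;
  the scaling is forced by the prescribed structure constants, see \<open>berger_frame_brackets\<close>.
\<close>

definition berger_basis :: "real \<Rightarrow> real \<Rightarrow> nat \<Rightarrow> quat" where
  "berger_basis \<kappa> \<tau> n =
     (if n = 1 then (sqrt \<kappa> / 2) *\<^sub>R (0, 1)
      else if n = 2 then (sqrt \<kappa> / 2) *\<^sub>R (0, \<i>)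
      else (\<kappa> / (2 * \<tau>)) *\<^sub>R (\<i>, 0))"

definition berger_frame :: "real \<Rightarrow> real \<Rightarrow> nat \<Rightarrow> quat \<Rightarrow> quat" where
  "berger_frame \<kappa> \<tau> n = linv (berger_basis \<kappa> \<tau> n)"

text \<open>
  The basis is orthogonal for the Euclidean product, so \<open>(\<xi> \<bullet> u\<^sub>n) / (u\<^sub>n \<bullet> u\<^sub>n)\<close> is the
  \<open>n\<close>-th coordinate of \<open>\<xi>\<close>.
\<close>

definition berger_coord :: "real \<Rightarrow> real \<Rightarrow> nat \<Rightarrow> quat \<Rightarrow> real" where
  "berger_coord \<kappa> \<tau> n \<xi> =
     (\<xi> \<bullet> berger_basis \<kappa> \<tau> n) / (berger_basis \<kappa> \<tau> n \<bullet> berger_basis \<kappa> \<tau> n)"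

definition berger_metric :: "real \<Rightarrow> real \<Rightarrow> quat \<Rightarrow> quat \<Rightarrow> quat \<Rightarrow> real" where
  "berger_metric \<kappa> \<tau> x v w =
     (\<Sum>n\<in>{1..3}. berger_coord \<kappa> \<tau> n (qconj x \<odot> v) * berger_coord \<kappa> \<tau> n (qconj x \<odot> w))"

section \<open>Levi-Civita connection, curvature, covariant derivative along curves\<close>

text \<open>The right-hand side of the Koszul formula for \<open>2 g(\<nabla>\<^sub>X Y, Z)\<close>.\<close>

definition koszul :: "real \<Rightarrow> real \<Rightarrow> (quat \<Rightarrow> quat) \<Rightarrow> (quat \<Rightarrow> quat) \<Rightarrow> (quat \<Rightarrow> quat) \<Rightarrow> quat \<Rightarrow> real"
  where
  "koszul \<kappa> \<tau> X Y Z x =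
     (let g = berger_metric \<kappa> \<tau> in
        dir_deriv (\<lambda>y. g y (Y y) (Z y)) x (X x)
      + dir_deriv (\<lambda>y. g y (X y) (Z y)) x (Y x)
      - dir_deriv (\<lambda>y. g y (X y) (Y y)) x (Z x)
      + g x (vf_bracket X Y x) (Z x)
      - g x (vf_bracket X Z x) (Y x)
      - g x (vf_bracket Y Z x) (X x))"

definition nabla :: "real \<Rightarrow> real \<Rightarrow> (quat \<Rightarrow> quat) \<Rightarrow> (quat \<Rightarrow> quat) \<Rightarrow> quat \<Rightarrow> quat" where
  "nabla \<kappa> \<tau> X Y =
     (\<lambda>x. \<Sum>n\<in>{1..3}. (koszul \<kappa> \<tau> X Y (berger_frame \<kappa> \<tau> n) x / 2) *\<^sub>R berger_frame \<kappa> \<tau> n x)"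

definition curvature_vf ::
  "real \<Rightarrow> real \<Rightarrow> (quat \<Rightarrow> quat) \<Rightarrow> (quat \<Rightarrow> quat) \<Rightarrow> (quat \<Rightarrow> quat) \<Rightarrow> quat \<Rightarrow> quat" where
  "curvature_vf \<kappa> \<tau> X Y Z = (\<lambda>x.
       nabla \<kappa> \<tau> X (nabla \<kappa> \<tau> Y Z) x
     - nabla \<kappa> \<tau> Y (nabla \<kappa> \<tau> X Z) x
     - nabla \<kappa> \<tau> (vf_bracket X Y) Z x)"

text \<open>
  The curvature is tensorial, so for tangent vectors it may be computed from any extension to
  vector fields; the left-invariant one is used.
\<close>

definition linv_ext :: "quat \<Rightarrow> quat \<Rightarrow> quat \<Rightarrow> quat" where
  "linv_ext x v = linv (qconj x \<odot> v)"

definition curvature :: "real \<Rightarrow> real \<Rightarrow> quat \<Rightarrow> quat \<Rightarrow> quat \<Rightarrow> quat \<Rightarrow> quat" where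
  "curvature \<kappa> \<tau> x u v w = curvature_vf \<kappa> \<tau> (linv_ext x u) (linv_ext x v) (linv_ext x w) x"

definition smooth_curve :: "(real \<Rightarrow> quat) \<Rightarrow> bool" where
  "smooth_curve \<gamma> \<longleftrightarrow> smooth_on UNIV \<gamma> \<and> range \<gamma> \<subseteq> S3"

definition velocity :: "(real \<Rightarrow> quat) \<Rightarrow> real \<Rightarrow> quat" where
  "velocity \<gamma> = (\<lambda>t. vector_derivative \<gamma> (at t))"

definition field_along :: "(real \<Rightarrow> quat) \<Rightarrow> (real \<Rightarrow> quat) \<Rightarrow> bool" where
  "field_along \<gamma> V \<longleftrightarrow> smooth_on UNIV V \<and> (\<forall>t. V t \<in> tangent (\<gamma> t))"

text \<open>
  With \<open>V = \<Sum> V\<^sub>n u\<^sub>n\<close> along \<open>\<gamma>\<close>, the covariant derivative is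
  \<open>\<Sum> (V\<^sub>n' u\<^sub>n + V\<^sub>n \<nabla>\<^bsub>\<gamma>'\<^esub> u\<^sub>n)\<close>.
\<close>

definition cov_deriv :: "real \<Rightarrow> real \<Rightarrow> (real \<Rightarrow> quat) \<Rightarrow> (real \<Rightarrow> quat) \<Rightarrow> real \<Rightarrow> quat" where
  "cov_deriv \<kappa> \<tau> \<gamma> V = (\<lambda>t. \<Sum>n\<in>{1..3}.
       deriv (\<lambda>s. berger_metric \<kappa> \<tau> (\<gamma> s) (V s) (berger_frame \<kappa> \<tau> n (\<gamma> s))) t
         *\<^sub>R berger_frame \<kappa> \<tau> n (\<gamma> t)
     + berger_metric \<kappa> \<tau> (\<gamma> t) (V t) (berger_frame \<kappa> \<tau> n (\<gamma> t))
         *\<^sub>R nabla \<kappa> \<tau> (linv_ext (\<gamma> t) (velocity \<gamma> t)) (berger_frame \<kappa> \<tau> n) (\<gamma> t))"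

section \<open>Geodesics, Jacobi fields, Killing fields, isotropy\<close>

definition geodesic :: "real \<Rightarrow> real \<Rightarrow> (real \<Rightarrow> quat) \<Rightarrow> bool" where
  "geodesic \<kappa> \<tau> \<gamma> \<longleftrightarrow>
     smooth_curve \<gamma> \<and> (\<forall>t. cov_deriv \<kappa> \<tau> \<gamma> (velocity \<gamma>) t = 0) \<and> (\<exists>t. \<gamma> t \<noteq> \<gamma> 0)"

definition jacobi_field :: "real \<Rightarrow> real \<Rightarrow> (real \<Rightarrow> quat) \<Rightarrow> (real \<Rightarrow> quat) \<Rightarrow> bool" where
  "jacobi_field \<kappa> \<tau> \<gamma> J \<longleftrightarrow>
     field_along \<gamma> J \<and>
     (\<forall>t. cov_deriv \<kappa> \<tau> \<gamma> (cov_deriv \<kappa> \<tau> \<gamma> J) t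
          + curvature \<kappa> \<tau> (\<gamma> t) (J t) (velocity \<gamma> t) (velocity \<gamma> t) = 0)"

text \<open>Killing fields: the Lie derivative of the metric vanishes.\<close>

definition lie_deriv_metric ::
  "real \<Rightarrow> real \<Rightarrow> (quat \<Rightarrow> quat) \<Rightarrow> (quat \<Rightarrow> quat) \<Rightarrow> (quat \<Rightarrow> quat) \<Rightarrow> quat \<Rightarrow> real" where
  "lie_deriv_metric \<kappa> \<tau> X Y Z x =
     dir_deriv (\<lambda>y. berger_metric \<kappa> \<tau> y (Y y) (Z y)) x (X x)
   - berger_metric \<kappa> \<tau> x (vf_bracket X Y x) (Z x)
   - berger_metric \<kappa> \<tau> x (Y x) (vf_bracket X Z x)"

definition killing_field :: "real \<Rightarrow> real \<Rightarrow> (quat \<Rightarrow> quat) \<Rightarrow> bool" where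
  "killing_field \<kappa> \<tau> X \<longleftrightarrow>
     vector_field X \<and>
     (\<forall>Y Z. vector_field Y \<longrightarrow> vector_field Z \<longrightarrow> (\<forall>x\<in>S3. lie_deriv_metric \<kappa> \<tau> X Y Z x = 0))"

definition isotropic_jacobi_field :: "real \<Rightarrow> real \<Rightarrow> (real \<Rightarrow> quat) \<Rightarrow> (real \<Rightarrow> quat) \<Rightarrow> bool" where
  "isotropic_jacobi_field \<kappa> \<tau> \<gamma> J \<longleftrightarrow>
     jacobi_field \<kappa> \<tau> \<gamma> J \<and> (\<exists>X. killing_field \<kappa> \<tau> X \<and> (\<forall>t. J t = X (\<gamma> t)))"

text \<open>As usual, conjugate points and their isotropy are indexed by the parameter \<open>t \<noteq> 0\<close>.\<close>

definition conjugate_at :: "real \<Rightarrow> real \<Rightarrow> (real \<Rightarrow> quat) \<Rightarrow> real \<Rightarrow> bool" where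
  "conjugate_at \<kappa> \<tau> \<gamma> t \<longleftrightarrow>
     t \<noteq> 0 \<and> (\<exists>J. jacobi_field \<kappa> \<tau> \<gamma> J \<and> (\<exists>s. J s \<noteq> 0) \<and> J 0 = 0 \<and> J t = 0)"

definition isotropic_at :: "real \<Rightarrow> real \<Rightarrow> (real \<Rightarrow> quat) \<Rightarrow> real \<Rightarrow> bool" where
  "isotropic_at \<kappa> \<tau> \<gamma> t \<longleftrightarrow>
     (\<exists>J. isotropic_jacobi_field \<kappa> \<tau> \<gamma> J \<and> (\<exists>s. J s \<noteq> 0) \<and> J 0 = 0 \<and> J t = 0)"

definition isotropic_geodesic :: "real \<Rightarrow> real \<Rightarrow> (real \<Rightarrow> quat) \<Rightarrow> bool" where
  "isotropic_geodesic \<kappa> \<tau> \<gamma> \<longleftrightarrow>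
     geodesic \<kappa> \<tau> \<gamma> \<and> (\<forall>t. conjugate_at \<kappa> \<tau> \<gamma> t \<longrightarrow> isotropic_at \<kappa> \<tau> \<gamma> t)"

section \<open>The model is the intended Riemannian Lie group\<close>

lemma qmult_assoc: "(p \<odot> q) \<odot> r = p \<odot> (q \<odot> r)"
  by (simp add: qmult_def algebra_simps)

lemma qone_mult [simp]: "qone \<odot> p = p" and mult_qone [simp]: "p \<odot> qone = p"
  by (simp_all add: qmult_def qone_def)

lemma inner_quat: "(p::quat) \<bullet> q = Re (fst p) * Re (fst q) + Im (fst p) * Im (fst q)
    + Re (snd p) * Re (snd q) + Im (snd p) * Im (snd q)"
  by (simp add: inner_prod_def inner_complex_def)

lemma quat_eq_iff: "(p::quat) = q \<longleftrightarrow> Re (fst p) = Re (fst q) \<and> Im (fst p) = Im (fst q)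
    \<and> Re (snd p) = Re (snd q) \<and> Im (snd p) = Im (snd q)"
  by (auto simp: prod_eq_iff complex_eq_iff)

lemma inner_qmult_left: "(p \<odot> q) \<bullet> (p \<odot> r) = (p \<bullet> p) * (q \<bullet> r)"
  by (simp add: inner_quat qmult_def algebra_simps)

lemma S3_iff: "x \<in> S3 \<longleftrightarrow> x \<bullet> x = 1"
  by (simp add: norm_eq_sqrt_inner)

lemma qconj_mult_self: "x \<in> S3 \<Longrightarrow> qconj x \<odot> x = qone" "x \<in> S3 \<Longrightarrow> x \<odot> qconj x = qone"
  unfolding S3_iff
  by (auto simp: quat_eq_iff qmult_def qconj_def qone_def inner_quat algebra_simps)

lemma S3_group:
  "qone \<in> S3"
  "x \<in> S3 \<Longrightarrow> y \<in> S3 \<Longrightarrow> x \<odot> y \<in> S3"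
  "x \<in> S3 \<Longrightarrow> qconj x \<in> S3"
  unfolding S3_iff
  by (simp add: qone_def inner_quat, metis inner_qmult_left mult_1,
      simp add: inner_quat qconj_def)

lemma simply_connected_S3: "simply_connected S3"
  by (rule simply_connected_sphere) simp

lemma linv_tangent:
  assumes "x \<in> S3" "\<xi> \<in> tangent qone"
  shows "linv \<xi> x \<in> tangent x"
proof -
  have "linv \<xi> x \<bullet> x = (x \<odot> \<xi>) \<bullet> (x \<odot> qone)" by (simp add: linv_def)
  then show ?thesis using assms inner_qmult_left[of x \<xi> qone]
    by (simp add: tangent_def)
qed

lemma berger_basis_tangent: "berger_basis \<kappa> \<tau> n \<in> tangent qone"
  by (simp add: tangent_def berger_basis_def qone_def inner_quat)

lemma berger_coord_basis:
  assumes "\<kappa> > 0" "\<tau> > 0" "m \<in> {1..3}" "n \<in> {1..3}"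
  shows "berger_coord \<kappa> \<tau> n (berger_basis \<kappa> \<tau> m) = (if m = n then 1 else 0)"
proof -
  have "m = 1 \<or> m = 2 \<or> m = 3" "n = 1 \<or> n = 2 \<or> n = 3" using assms by auto
  then show ?thesis using assms(1,2)
    by (auto simp: berger_coord_def berger_basis_def inner_quat)
qed

lemma berger_metric_left_invariant:
  assumes "a \<in> S3" "x \<in> S3"
  shows "berger_metric \<kappa> \<tau> (a \<odot> x) (a \<odot> v) (a \<odot> w) = berger_metric \<kappa> \<tau> x v w"
proof -
  have "qconj (a \<odot> x) \<odot> (a \<odot> v) = qconj x \<odot> v" for v
  proof -
    have "qconj (a \<odot> x) = qconj x \<odot> qconj a"
      by (simp add: qconj_def qmult_def algebra_simps)
    then have "qconj (a \<odot> x) \<odot> (a \<odot> v) = qconj x \<odot> ((qconj a \<odot> a) \<odot> v)"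
      by (simp add: qmult_assoc)
    then show ?thesis using assms(1) by (simp only: qconj_mult_self qone_mult)
  qed
  then show ?thesis by (simp add: berger_metric_def)
qed

lemma berger_frame_orthonormal:
  assumes "\<kappa> > 0" "\<tau> > 0" "x \<in> S3" "m \<in> {1..3}" "n \<in> {1..3}"
  shows "berger_metric \<kappa> \<tau> x (berger_frame \<kappa> \<tau> m x) (berger_frame \<kappa> \<tau> n x) = (if m = n then 1 else 0)"
proof -
  have "qconj x \<odot> berger_frame \<kappa> \<tau> k x = berger_basis \<kappa> \<tau> k" for k
    using assms(3) by (simp add: berger_frame_def linv_def qmult_assoc[symmetric] qconj_mult_self
        del: mem_sphere_0)
  then have "berger_metric \<kappa> \<tau> x (berger_frame \<kappa> \<tau> m x) (berger_frame \<kappa> \<tau> n x)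
      = (\<Sum>k\<in>{1..3}. (if m = k then 1 else 0) * (if n = k then 1 else 0))"
    using assms by (simp add: berger_metric_def berger_coord_basis)
  also have "\<dots> = (\<Sum>k\<in>{1..3}. if k = m then if m = n then 1 else 0 else 0)"
    by (rule sum.cong) auto
  also have "\<dots> = (if m = n then 1 else 0)"
    using assms(4) by (subst sum.delta) auto
  finally show ?thesis .
qed

lemma has_derivative_sgn_S3:
  assumes "x \<in> S3"
  shows "((sgn :: quat \<Rightarrow> quat) has_derivative (\<lambda>v. v - (v \<bullet> x) *\<^sub>R x)) (at x)"
proof -
  have x: "norm x = 1" "x \<noteq> 0" "sgn x = x" using assms by (auto simp: sgn_div_norm)
  have n: "(norm has_derivative (\<lambda>v. v \<bullet> x)) (at x)"
    using has_derivative_norm[OF x(2)] x(3) by simp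
  show ?thesis
    unfolding sgn_div_norm
    by (rule derivative_eq_intros n refl | use x in simp)+
qed

lemma dir_deriv_linv:
  assumes "x \<in> S3" "v \<in> tangent x"
  shows "dir_deriv (linv \<xi>) x v = v \<odot> \<xi>"
proof -
  have lin: "bounded_linear (linv \<xi>)"
    by (rule linear_conv_bounded_linear[THEN iffD1], rule linearI)
       (auto simp: linv_def qmult_def quat_eq_iff algebra_simps)
  have "(linv \<xi> \<circ> sgn has_derivative linv \<xi> \<circ> (\<lambda>v. v - (v \<bullet> x) *\<^sub>R x)) (at x)"
    using assms(1) by (intro diff_chain_at has_derivative_sgn_S3 bounded_linear_imp_has_derivative lin)
  then have "frechet_derivative (linv \<xi> \<circ> sgn) (at x) = linv \<xi> \<circ> (\<lambda>v. v - (v \<bullet> x) *\<^sub>R x)"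
    by (rule frechet_derivative_at[symmetric])
  then show ?thesis using assms(2)
    by (simp add: dir_deriv_def tangent_def linv_def)
qed

lemma vf_bracket_linv:
  assumes "x \<in> S3" "\<xi> \<in> tangent qone" "\<eta> \<in> tangent qone"
  shows "vf_bracket (linv \<xi>) (linv \<eta>) x = linv (\<xi> \<odot> \<eta> - \<eta> \<odot> \<xi>) x"
  using assms
  by (simp add: vf_bracket_def dir_deriv_linv linv_tangent del: mem_sphere_0)
     (simp add: linv_def qmult_def algebra_simps)

lemma berger_frame_brackets:
  assumes "\<kappa> > 0" "\<tau> > 0" "x \<in> S3"
  shows "vf_bracket (berger_frame \<kappa> \<tau> 1) (berger_frame \<kappa> \<tau> 2) x = \<tau> *\<^sub>R berger_frame \<kappa> \<tau> 3 x"
    and "vf_bracket (berger_frame \<kappa> \<tau> 2) (berger_frame \<kappa> \<tau> 3) x = (\<kappa> / \<tau>) *\<^sub>R berger_frame \<kappa> \<tau> 1 x"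
    and "vf_bracket (berger_frame \<kappa> \<tau> 3) (berger_frame \<kappa> \<tau> 1) x = (\<kappa> / \<tau>) *\<^sub>R berger_frame \<kappa> \<tau> 2 x"
proof -
  let ?e = "berger_basis \<kappa> \<tau>"
  have s: "sqrt \<kappa> * sqrt \<kappa> = \<kappa>" using assms by simp
  have 1: "?e 1 \<odot> ?e 2 - ?e 2 \<odot> ?e 1 = \<tau> *\<^sub>R ?e 3"
    and 2: "?e 2 \<odot> ?e 3 - ?e 3 \<odot> ?e 2 = (\<kappa> / \<tau>) *\<^sub>R ?e 1"
    and 3: "?e 3 \<odot> ?e 1 - ?e 1 \<odot> ?e 3 = (\<kappa> / \<tau>) *\<^sub>R ?e 2"
    using assms(1,2) s by (auto simp: quat_eq_iff qmult_def berger_basis_def field_simps)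
  have lin: "linv (c *\<^sub>R \<xi>) x = c *\<^sub>R linv \<xi> x" for c \<xi>
    by (simp add: linv_def qmult_def quat_eq_iff algebra_simps)
  have b: "vf_bracket (berger_frame \<kappa> \<tau> m) (berger_frame \<kappa> \<tau> n) x
      = linv (?e m \<odot> ?e n - ?e n \<odot> ?e m) x" for m n
    using assms(3) by (simp add: berger_frame_def vf_bracket_linv berger_basis_tangent del: mem_sphere_0)
  show "vf_bracket (berger_frame \<kappa> \<tau> 1) (berger_frame \<kappa> \<tau> 2) x = \<tau> *\<^sub>R berger_frame \<kappa> \<tau> 3 x"
    by (simp only: b 1 lin) (simp only: berger_frame_def)
  show "vf_bracket (berger_frame \<kappa> \<tau> 2) (berger_frame \<kappa> \<tau> 3) x = (\<kappa> / \<tau>) *\<^sub>R berger_frame \<kappa> \<tau> 1 x"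
    by (simp only: b 2 lin) (simp only: berger_frame_def)
  show "vf_bracket (berger_frame \<kappa> \<tau> 3) (berger_frame \<kappa> \<tau> 1) x = (\<kappa> / \<tau>) *\<^sub>R berger_frame \<kappa> \<tau> 2 x"
    by (simp only: b 3 lin) (simp only: berger_frame_def)
qed

lemma dir_deriv_const:
  assumes "x \<in> S3" "\<And>y. y \<in> S3 \<Longrightarrow> f y = c"
  shows "dir_deriv f x v = 0"
proof -
  have "x \<noteq> 0" using assms(1) by auto
  have "((\<lambda>_. c) has_derivative (\<lambda>_. 0)) (at x)" by simp
  then have "(f \<circ> sgn has_derivative (\<lambda>_. 0)) (at x)"
    by (rule has_derivative_transform_within_open[of _ _ _ _ "- {0}"])
       (use \<open>x \<noteq> 0\<close> assms(2) in \<open>auto simp: norm_sgn\<close>)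
  then have "frechet_derivative (f \<circ> sgn) (at x) = (\<lambda>_. 0)"
    by (rule frechet_derivative_at[symmetric])
  then show ?thesis by (simp add: dir_deriv_def)
qed

text \<open>The connection in the frame; with the brackets above it yields the Christoffel symbols.\<close>

lemma koszul_frame:
  assumes "\<kappa> > 0" "\<tau> > 0" "x \<in> S3" "l \<in> {1..3}" "m \<in> {1..3}" "n \<in> {1..3}"
  defines "u \<equiv> berger_frame \<kappa> \<tau>" and "g \<equiv> berger_metric \<kappa> \<tau> x"
  shows "koszul \<kappa> \<tau> (u l) (u m) (u n) x =
    g (vf_bracket (u l) (u m) x) (u n x) - g (vf_bracket (u l) (u n) x) (u m x)
      - g (vf_bracket (u m) (u n) x) (u l x)"
proof -
  have "dir_deriv (\<lambda>y. berger_metric \<kappa> \<tau> y (u i y) (u j y)) x v = 0"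
    if "i \<in> {1..3}" "j \<in> {1..3}" for i j v
    using assms(1-3) that unfolding u_def
    by (intro dir_deriv_const[where c = "if i = j then 1 else 0"]) (auto simp only: berger_frame_orthonormal)
  then show ?thesis using assms(4-6) by (simp add: koszul_def g_def Let_def)
qed

end

theory Submission
  imports Defs
begin

text \<open>
  Write \<open>\<gamma>' = \<gamma> (a u\<^sub>1 + b u\<^sub>2 + c u\<^sub>3)\<close>; along a geodesic \<open>c\<close> and \<open>h = a\<^sup>2 + b\<^sup>2\<close> are constant
  and \<open>(a, b)\<close> rotates uniformly.  In the frame rotating with it the Jacobi equation has constant
  coefficients.  If \<open>h > 0\<close>, put \<open>w\<^sup>2 = \<kappa> h + \<tau>\<^sup>2 c\<^sup>2\<close>; then \<open>2 s / w\<close> is a conjugate parameter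
  for every root \<open>s > 0\<close> of \<open>(\<kappa> - \<tau>\<^sup>2) h s cos s + \<tau>\<^sup>2 (h + c\<^sup>2) sin s = 0\<close>, and since \<open>\<kappa> \<noteq> \<tau>\<^sup>2\<close> there is one
  with \<open>sin (2 s) \<noteq> 0\<close>.  A Killing field vanishing at \<open>\<gamma> 0\<close> has along \<open>\<gamma>\<close> a component proportional to
  \<open>sin (w t)\<close>, so if it also vanishes at that parameter, it vanishes on all of \<open>\<gamma>\<close>.  If \<open>h = 0\<close>, then
  \<open>\<gamma>\<close> is a Hopf fibre: it has conjugate points, but every Killing field vanishing at \<open>\<gamma> 0\<close> vanishes along it.
\<close>

section \<open>Smooth maps\<close>

text \<open>Since \<open>S\<close> is open, derivatives at its points depend only on values in
  \<open>S\<close>, so agreement on \<open>S\<close> passes to all iterated derivatives.\<close>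

lemma Ck_on_cong:
  assumes "open S" "\<And>x. x \<in> S \<Longrightarrow> f x = g x"
  shows "Ck_on n S f \<longleftrightarrow> Ck_on n S g"
  using assms(2)
proof (induction n arbitrary: f g)
  case 0
  then show ?case by (simp cong: continuous_on_cong)
next
  case (Suc n)
  have *: "Ck_on n S (\<lambda>x. frechet_derivative f (at x) v) \<longleftrightarrow> Ck_on n S (\<lambda>x. frechet_derivative g (at x) v)"
    if "f differentiable_on S" for v
  proof (rule Suc.IH)
    fix x assume "x \<in> S"
    then show "frechet_derivative f (at x) v = frechet_derivative g (at x) v"
      using frechet_derivative_transform_within_open[of f x S g] that assms(1) Suc.prems
      by (metis differentiable_on_eq_differentiable_at)
  qed
  have "f differentiable_on S \<longleftrightarrow> g differentiable_on S"
    by (metis Suc.prems differentiable_on_def differentiable_transform_within zero_less_one)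
  then show ?case using * by (simp del: ball_simps) blast
qed

lemma smooth_on_cong:
  assumes "open S" "\<And>x. x \<in> S \<Longrightarrow> f x = g x"
  shows "smooth_on S f \<longleftrightarrow> smooth_on S g"
  using Ck_on_cong[OF assms] by (simp add: smooth_on_def)

lemma Ck_on_SucD: "Ck_on (Suc n) S f \<Longrightarrow> Ck_on n S f"
  by (induction n arbitrary: f) (auto intro: differentiable_imp_continuous_on)

lemma Ck_on_imp_has_derivative:
  assumes "Ck_on (Suc n) S f" "open S" "x \<in> S"
  shows "(f has_derivative frechet_derivative f (at x)) (at x)"
  using assms by (metis Ck_on.simps(2) differentiable_on_eq_differentiable_at frechet_derivative_works)

lemma smooth_on_imp_has_derivative:
  assumes "smooth_on S f" "open S" "x \<in> S"
  shows "(f has_derivative frechet_derivative f (at x)) (at x)"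
  using assms Ck_on_imp_has_derivative unfolding smooth_on_def by blast

text \<open>By uniqueness of derivatives an explicit family \<open>f'\<close> may stand in for the
  chosen \<open>frechet_derivative\<close>; this is how concrete formulas enter inductions on
  \<open>n\<close>.\<close>

lemma Ck_on_SucI:
  assumes "open S" "\<And>x. x \<in> S \<Longrightarrow> (f has_derivative f' x) (at x)" "\<And>v. Ck_on n S (\<lambda>x. f' x v)"
  shows "Ck_on (Suc n) S f"
proof -
  have "f differentiable_on S"
    using assms(1,2) by (meson differentiable_at_withinI differentiable_def differentiable_on_def)
  moreover have "Ck_on n S (\<lambda>x. frechet_derivative f (at x) v)" for v
    using assms(3)[of v] by (rule Ck_on_cong[OF assms(1), THEN iffD1, rotated])
      (simp add: frechet_derivative_at[OF assms(2), symmetric])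
  ultimately show ?thesis by simp
qed

section \<open>Closure of smoothness under linear and bilinear operations\<close>

lemma Ck_on_const: "Ck_on n S (\<lambda>_. c)"
  by (induction n arbitrary: c) auto

lemma Ck_on_bounded_linear:
  assumes "open S" "bounded_linear L" "Ck_on n S f"
  shows "Ck_on n S (\<lambda>x. L (f x))"
  using assms(3)
proof (induction n arbitrary: f)
  case 0
  then show ?case using assms(2) by (simp add: bounded_linear.continuous_on)
next
  case (Suc n)
  show ?case
  proof (rule Ck_on_SucI[OF assms(1)])
    show "((\<lambda>x. L (f x)) has_derivative (\<lambda>v. L (frechet_derivative f (at x) v))) (at x)" if "x \<in> S" for x
      using bounded_linear.has_derivative[OF assms(2)] Ck_on_imp_has_derivative[OF Suc.prems assms(1) that]
      by blast
  qed (use Suc in auto)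
qed

lemma Ck_on_add:
  assumes "open S" "Ck_on n S f" "Ck_on n S g"
  shows "Ck_on n S (\<lambda>x. f x + g x)"
  using assms(2,3)
proof (induction n arbitrary: f g)
  case 0
  then show ?case by (simp add: continuous_on_add)
next
  case (Suc n)
  show ?case
  proof (rule Ck_on_SucI[OF assms(1)])
    fix x assume "x \<in> S"
    then show "((\<lambda>x. f x + g x) has_derivative
        (\<lambda>v. frechet_derivative f (at x) v + frechet_derivative g (at x) v)) (at x)"
      using Suc.prems assms(1) by (intro has_derivative_add Ck_on_imp_has_derivative)
  qed (use Suc in auto)
qed

text \<open>Induction on both factors at once: the product rule pairs the derivative of one factor
  with the other factor itself, whose order is lowered by \<open>Ck_on_SucD\<close>.\<close>

lemma Ck_on_bilinear:
  assumes "open S" "bounded_bilinear B" "Ck_on n S f" "Ck_on n S g"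
  shows "Ck_on n S (\<lambda>x. B (f x) (g x))"
  using assms(3,4)
proof (induction n arbitrary: f g)
  case 0
  then show ?case using assms(2) by (simp add: bounded_bilinear.continuous_on)
next
  case (Suc n)
  show ?case
  proof (rule Ck_on_SucI[OF assms(1)])
    fix x assume "x \<in> S"
    then show "((\<lambda>x. B (f x) (g x)) has_derivative
        (\<lambda>v. B (f x) (frechet_derivative g (at x) v) + B (frechet_derivative f (at x) v) (g x))) (at x)"
      using Suc.prems assms(1) by (intro bounded_bilinear.FDERIV[OF assms(2)] Ck_on_imp_has_derivative)
  next
    show "Ck_on n S (\<lambda>x. B (f x) (frechet_derivative g (at x) v) + B (frechet_derivative f (at x) v) (g x))" for v
      using Suc.prems by (intro Ck_on_add[OF assms(1)] Suc.IH) (auto dest: Ck_on_SucD simp del: Ck_on.simps, auto)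
  qed
qed

lemma smooth_on_const: "smooth_on S (\<lambda>_. c)"
  by (simp add: smooth_on_def Ck_on_const)

lemma smooth_on_bounded_linear:
  "open S \<Longrightarrow> bounded_linear L \<Longrightarrow> smooth_on S f \<Longrightarrow> smooth_on S (\<lambda>x. L (f x))"
  by (simp add: smooth_on_def Ck_on_bounded_linear)

lemma smooth_on_add:
  "open S \<Longrightarrow> smooth_on S f \<Longrightarrow> smooth_on S g \<Longrightarrow> smooth_on S (\<lambda>x. f x + g x)"
  by (simp add: smooth_on_def Ck_on_add)

lemma smooth_on_sum:
  "open S \<Longrightarrow> (\<And>i. i \<in> I \<Longrightarrow> smooth_on S (f i)) \<Longrightarrow> smooth_on S (\<lambda>x. \<Sum>i\<in>I. f i x)"
  by (induction I rule: infinite_finite_induct) (auto intro: smooth_on_const smooth_on_add)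

lemma smooth_on_bilinear:
  "open S \<Longrightarrow> bounded_bilinear B \<Longrightarrow> smooth_on S f \<Longrightarrow> smooth_on S g \<Longrightarrow> smooth_on S (\<lambda>x. B (f x) (g x))"
  by (simp add: smooth_on_def Ck_on_bilinear)

lemma smooth_on_frechet_derivative: "smooth_on S f \<Longrightarrow> smooth_on S (\<lambda>x. frechet_derivative f (at x) v)"
  unfolding smooth_on_def using Ck_on.simps(2) by blast

lemma smooth_on_imp_continuous_on: "smooth_on S f \<Longrightarrow> continuous_on S f"
  unfolding smooth_on_def using Ck_on.simps(1) by blast

lemma smooth_on_id: "open S \<Longrightarrow> smooth_on S (\<lambda>x. x)"
  unfolding smooth_on_def
proof
  fix n assume "open S"
  then show "Ck_on n S (\<lambda>x. x)"
    by (cases n) (auto intro!: Ck_on_SucI[where f' = "\<lambda>_ v. v"] Ck_on_const simp del: Ck_on.simps(2))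
qed

text \<open>Differentiation exchanges the two functions up to a constant factor, so the induction
  treats them jointly.\<close>

lemma smooth_on_sin_cos: "smooth_on UNIV (\<lambda>t::real. sin (c * t + d))" "smooth_on UNIV (\<lambda>t::real. cos (c * t + d))"
proof -
  have "Ck_on n UNIV (\<lambda>t::real. sin (c * t + d)) \<and> Ck_on n UNIV (\<lambda>t::real. cos (c * t + d))" for n
  proof (induction n)
    case 0
    show ?case by (auto intro!: continuous_intros)
  next
    case (Suc n)
    have 1: "Ck_on n UNIV (\<lambda>t. (c * v) * cos (c * t + d))" "Ck_on n UNIV (\<lambda>t. (- c * v) * sin (c * t + d))" for v :: real
      using Suc by (intro Ck_on_bounded_linear[OF open_UNIV bounded_linear_mult_right]; simp)+
    have 2: "((\<lambda>t. sin (c * t + d)) has_derivative (\<lambda>v. (c * v) * cos (c * t + d))) (at t)"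
      "((\<lambda>t. cos (c * t + d)) has_derivative (\<lambda>v. (- c * v) * sin (c * t + d))) (at t)" for t
      by (auto intro!: derivative_eq_intros)
    show ?case using Ck_on_SucI[OF open_UNIV 2(1) 1(1)] Ck_on_SucI[OF open_UNIV 2(2) 1(2)] by blast
  qed
  then show "smooth_on UNIV (\<lambda>t::real. sin (c * t + d))" "smooth_on UNIV (\<lambda>t::real. cos (c * t + d))"
    by (auto simp: smooth_on_def)
qed

text \<open>The derivative of 1/|x| is a product of copies of 1/|x| with a linear function, so the
  induction closes; \<open>sgn\<close> is then 1/|x| times the identity.\<close>

lemma smooth_on_sgn: "smooth_on (- {0}) (sgn :: 'a::real_inner \<Rightarrow> 'a)"
proof -
  have o: "open (- {0::'a})" by auto
  have "Ck_on n (- {0}) (\<lambda>x::'a. inverse (norm x))" for n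
  proof (induction n)
    case 0
    show ?case by (auto intro!: continuous_intros)
  next
    case (Suc n)
    show ?case
    proof (rule Ck_on_SucI[OF o])
      fix x :: 'a assume "x \<in> - {0}"
      then show "((\<lambda>x. inverse (norm x)) has_derivative
          (\<lambda>v. - (inverse (norm x) * (inverse (norm x) * ((v \<bullet> x) * inverse (norm x)))))) (at x)"
        by (auto intro!: derivative_eq_intros has_derivative_norm
            simp: sgn_div_norm divide_inverse algebra_simps power2_eq_square)
    next
      have x: "Ck_on n (- {0}) (\<lambda>x::'a. v \<bullet> x)" for v
        using smooth_on_id[OF o]
        by (intro Ck_on_bounded_linear[OF o bounded_linear_inner_right]) (simp add: smooth_on_def)
      show "Ck_on n (- {0}) (\<lambda>x::'a. - (inverse (norm x) * (inverse (norm x) * ((v \<bullet> x) * inverse (norm x)))))" for v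
        using Suc
        by (intro Ck_on_bounded_linear[OF o bounded_linear_minus[OF bounded_linear_ident]]
            Ck_on_bilinear[OF o bounded_bilinear_mult] x)
    qed
  qed
  then have "smooth_on (- {0}) (\<lambda>x::'a. inverse (norm x) *\<^sub>R x)"
    by (intro smooth_on_bilinear[OF o bounded_bilinear_scaleR] smooth_on_id[OF o]) (auto simp: smooth_on_def)
  moreover have "(\<lambda>x::'a. inverse (norm x) *\<^sub>R x) = sgn" by (auto simp: sgn_div_norm)
  ultimately show ?thesis by simp
qed

text \<open>Schwarz's theorem: the second difference of \<open>f\<close> over a small parallelogram equals both mixed
  derivatives at nearby points, by the mean value theorem applied in either order.\<close>

lemma second_difference:
  fixes f :: "'a::real_normed_vector \<Rightarrow> real"
  assumes f: "smooth_on S f" and S: "open S" and t: "0 < t" and B: "ball x r \<subseteq> S"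
    and r: "t * norm v + t * norm w < r"
  shows "\<exists>y \<in> ball x r.
    f (x + t *\<^sub>R v + t *\<^sub>R w) - f (x + t *\<^sub>R v) - f (x + t *\<^sub>R w) + f x
    = t * t * frechet_derivative (\<lambda>y. frechet_derivative f (at y) v) (at y) w"
proof -
  define fv where "fv y = frechet_derivative f (at y) v" for y
  have fv: "smooth_on S fv" unfolding fv_def by (rule smooth_on_frechet_derivative[OF f])
  have near: "x + a *\<^sub>R v + b *\<^sub>R w \<in> ball x r" if "0 \<le> a" "a \<le> t" "0 \<le> b" "b \<le> t" for a b
  proof -
    have "norm (a *\<^sub>R v + b *\<^sub>R w) \<le> t * norm v + t * norm w"
      using that by (intro norm_triangle_le add_mono) (auto intro: mult_right_mono)
    moreover have "dist x (x + (a *\<^sub>R v + b *\<^sub>R w)) = norm (a *\<^sub>R v + b *\<^sub>R w)"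
      by (metis add_diff_cancel_left' dist_commute dist_norm)
    ultimately show ?thesis using r
      by (simp add: add.assoc)
  qed
  then have inS: "x + a *\<^sub>R v + b *\<^sub>R w \<in> S" if "0 \<le> a" "a \<le> t" "0 \<le> b" "b \<le> t" for a b
    using that B by blast
  have d1: "((\<lambda>a. f (x + a *\<^sub>R v + b *\<^sub>R w)) has_real_derivative fv (x + a *\<^sub>R v + b *\<^sub>R w)) (at a)"
    if "0 \<le> a" "a \<le> t" "0 \<le> b" "b \<le> t" for a b
  proof -
    let ?D = "frechet_derivative f (at (x + a *\<^sub>R v + b *\<^sub>R w))"
    have D: "(f has_derivative ?D) (at (x + a *\<^sub>R v + b *\<^sub>R w))"
      by (rule smooth_on_imp_has_derivative[OF f S inS[OF that]])
    have "((\<lambda>a. f (x + a *\<^sub>R v + b *\<^sub>R w)) has_derivative (\<lambda>h. ?D (h *\<^sub>R v))) (at a)"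
      by (rule has_derivative_compose[of "\<lambda>a. x + a *\<^sub>R v + b *\<^sub>R w" "\<lambda>h. h *\<^sub>R v" a UNIV f, OF _ D])
        (auto intro!: derivative_eq_intros)
    moreover have "(\<lambda>h. ?D (h *\<^sub>R v)) = (*) (?D v)"
      using linear_scale[OF has_derivative_linear[OF D]] by (auto simp: mult.commute)
    ultimately show ?thesis by (simp add: has_field_derivative_def fv_def)
  qed
  have d2: "((\<lambda>b. fv (x + a *\<^sub>R v + b *\<^sub>R w)) has_real_derivative
      frechet_derivative fv (at (x + a *\<^sub>R v + b *\<^sub>R w)) w) (at b)"
    if "0 \<le> a" "a \<le> t" "0 \<le> b" "b \<le> t" for a b
  proof -
    let ?D = "frechet_derivative fv (at (x + a *\<^sub>R v + b *\<^sub>R w))"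
    have D: "(fv has_derivative ?D) (at (x + a *\<^sub>R v + b *\<^sub>R w))"
      by (rule smooth_on_imp_has_derivative[OF fv S inS[OF that]])
    have "((\<lambda>b. fv (x + a *\<^sub>R v + b *\<^sub>R w)) has_derivative (\<lambda>h. ?D (h *\<^sub>R w))) (at b)"
      by (rule has_derivative_compose[of "\<lambda>b. x + a *\<^sub>R v + b *\<^sub>R w" "\<lambda>h. h *\<^sub>R w" b UNIV fv, OF _ D])
        (auto intro!: derivative_eq_intros)
    moreover have "(\<lambda>h. ?D (h *\<^sub>R w)) = (*) (?D w)"
      using linear_scale[OF has_derivative_linear[OF D]] by (auto simp: mult.commute)
    ultimately show ?thesis by (simp add: has_field_derivative_def)
  qed
  \<comment> \<open>The second difference is the increment over \<open>[0, t]\<close> of this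
    function. The mean value theorem is applied first along \<open>v\<close>, then along
    \<open>w\<close>; the term \<open>0 *\<^sub>R w\<close> below keeps the shape of
    \<open>d1\<close> and \<open>d2\<close>.\<close>
  let ?g = "\<lambda>a. f (x + a *\<^sub>R v + t *\<^sub>R w) - f (x + a *\<^sub>R v)"
  have "\<exists>a>0. a < t \<and> ?g t - ?g 0 = (t - 0) * (fv (x + a *\<^sub>R v + t *\<^sub>R w) - fv (x + a *\<^sub>R v + 0 *\<^sub>R w))"
  proof (rule MVT2[OF t])
    fix a assume "0 \<le> a" "a \<le> t"
    then show "(?g has_real_derivative fv (x + a *\<^sub>R v + t *\<^sub>R w) - fv (x + a *\<^sub>R v + 0 *\<^sub>R w)) (at a)"
      using d1[of a t] d1[of a 0] t by (auto intro: DERIV_diff)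
  qed
  then obtain a where a: "0 < a" "a < t"
    "?g t - ?g 0 = t * (fv (x + a *\<^sub>R v + t *\<^sub>R w) - fv (x + a *\<^sub>R v + 0 *\<^sub>R w))" by auto
  have "\<exists>b>0. b < t \<and> fv (x + a *\<^sub>R v + t *\<^sub>R w) - fv (x + a *\<^sub>R v + 0 *\<^sub>R w)
      = (t - 0) * frechet_derivative fv (at (x + a *\<^sub>R v + b *\<^sub>R w)) w"
    by (rule MVT2[OF t]) (use d2 a in auto)
  then obtain b where "0 < b" "b < t" "fv (x + a *\<^sub>R v + t *\<^sub>R w) - fv (x + a *\<^sub>R v + 0 *\<^sub>R w)
      = t * frechet_derivative fv (at (x + a *\<^sub>R v + b *\<^sub>R w)) w" by auto
  with a show ?thesis unfolding fv_def[symmetric]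
    by (intro bexI[of _ "x + a *\<^sub>R v + b *\<^sub>R w"] near) (simp_all add: algebra_simps)
qed

lemma frechet_derivative_commute:
  fixes f :: "'a::real_normed_vector \<Rightarrow> real"
  assumes f: "smooth_on S f" and S: "open S" and x: "x \<in> S"
  shows "frechet_derivative (\<lambda>y. frechet_derivative f (at y) v) (at x) w
    = frechet_derivative (\<lambda>y. frechet_derivative f (at y) w) (at x) v"
proof -
  define P where "P y = frechet_derivative (\<lambda>y. frechet_derivative f (at y) v) (at y) w" for y
  define Q where "Q y = frechet_derivative (\<lambda>y. frechet_derivative f (at y) w) (at y) v" for y
  obtain r where r: "r > 0" "ball x r \<subseteq> S" using S x openE by blast
  have cont: "isCont P x" "isCont Q x"
    unfolding P_def Q_def using S x f
    by (auto intro!: continuous_on_interior smooth_on_imp_continuous_on smooth_on_frechet_derivative simp: interior_open)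
  \<comment> \<open>The second difference is symmetric in \<open>v\<close> and \<open>w\<close>, so
    both mixed derivatives take a common value arbitrarily close to \<open>x\<close>; continuity at
    \<open>x\<close> finishes.\<close>
  have PQ: "\<exists>y\<in>ball x e. \<exists>z\<in>ball x e. P y = Q z" if e: "0 < e" "ball x e \<subseteq> S" for e
  proof -
    \<comment> \<open>The summand 1 keeps the denominator positive and makes the parallelogram lie
      strictly inside the ball.\<close>
    define t where "t = e / (norm v + norm w + 1)"
    have N: "norm v + norm w + 1 > 0" by (simp add: add_nonneg_pos)
    have t: "t > 0" unfolding t_def using e(1) N by (rule divide_pos_pos)
    have "t * (norm v + norm w + 1) = e" using N by (simp add: t_def)
    then have tvw: "t * norm v + t * norm w < e" "t * norm w + t * norm v < e"
      using t by (simp_all add: distrib_left)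
    obtain y where y: "y \<in> ball x e"
      "f (x + t *\<^sub>R v + t *\<^sub>R w) - f (x + t *\<^sub>R v) - f (x + t *\<^sub>R w) + f x = t * t * P y"
      using second_difference[OF f S t e(2) tvw(1)] unfolding P_def by blast
    obtain z where z: "z \<in> ball x e"
      "f (x + t *\<^sub>R w + t *\<^sub>R v) - f (x + t *\<^sub>R w) - f (x + t *\<^sub>R v) + f x = t * t * Q z"
      using second_difference[OF f S t e(2) tvw(2)] unfolding Q_def by blast
    have "t * t * P y = t * t * Q z"
      using y(2) z(2) by (simp add: algebra_simps)
    then have "P y = Q z" using t by simp
    then show ?thesis using y(1) z(1) by blast
  qed
  have "\<bar>P x - Q x\<bar> \<le> \<epsilon>" if eps: "\<epsilon> > 0" for \<epsilon>
  proof -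
    obtain d1 where d1: "d1 > 0" "\<And>y. dist y x < d1 \<Longrightarrow> dist (P y) (P x) < \<epsilon> / 2"
      using cont(1) eps unfolding continuous_at_eps_delta by (metis half_gt_zero)
    obtain d2 where d2: "d2 > 0" "\<And>y. dist y x < d2 \<Longrightarrow> dist (Q y) (Q x) < \<epsilon> / 2"
      using cont(2) eps unfolding continuous_at_eps_delta by (metis half_gt_zero)
    define e where "e = min r (min d1 d2)"
    have "e > 0" "ball x e \<subseteq> S" using r d1 d2 by (auto simp: e_def)
    then obtain y z where yz: "y \<in> ball x e" "z \<in> ball x e" "P y = Q z" using PQ by blast
    have "dist (P y) (P x) < \<epsilon> / 2" "dist (Q z) (Q x) < \<epsilon> / 2"
      using yz d1(2)[of y] d2(2)[of z] by (auto simp: e_def dist_commute)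
    then show ?thesis using yz(3) unfolding dist_real_def by linarith
  qed
  then have "P x = Q x" by (metis abs_le_zero_iff dense_ge eq_iff_diff_eq_0)
  then show ?thesis by (simp add: P_def Q_def)
qed


section \<open>Left-invariant calculus\<close>

text \<open>\<open>sgn\<close> maps the punctured space into the sphere, so the two compositions
  with \<open>sgn\<close> agree near \<open>x\<close>.\<close>

lemma dir_deriv_cong:
  assumes "x \<in> S3" "\<And>y. y \<in> S3 \<Longrightarrow> f y = g y"
  shows "dir_deriv f x v = dir_deriv g x v"
proof -
  have x: "x \<noteq> 0" using assms(1) by auto
  have o: "open (- {0 :: quat})" by (rule open_Compl) simp
  have eq: "f (sgn y) = g (sgn y)" if "y \<noteq> 0" for y
    using assms(2)[of "sgn y"] that by (simp add: norm_sgn)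
  \<comment> \<open>\<open>frechet_derivative\<close> is a choice among all derivatives, so having
    the same derivatives is enough, even without differentiability.\<close>
  have "(f \<circ> sgn has_derivative D) (at x) \<longleftrightarrow> (g \<circ> sgn has_derivative D) (at x)" for D
    by (rule iffI; erule has_derivative_transform_within_open[of _ _ _ _ "- {0}"])
       (use x eq o in \<open>simp_all del: split_paired_All\<close>)
  then show ?thesis by (simp add: dir_deriv_def frechet_derivative_def)
qed

lemma vf_bracket_cong:
  assumes "x \<in> S3" "\<And>y. y \<in> S3 \<Longrightarrow> X y = X' y" "\<And>y. y \<in> S3 \<Longrightarrow> Y y = Y' y"
  shows "vf_bracket X Y x = vf_bracket X' Y' x"
  using assms dir_deriv_cong[OF assms(1), of X X'] dir_deriv_cong[OF assms(1), of Y Y']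
  by (simp add: vf_bracket_def)

text \<open>Lets an inner connection or bracket term, computed only at points of the sphere, be
  replaced by an explicit left-invariant field under an outer \<open>nabla\<close>.\<close>

lemma nabla_cong:
  assumes "x \<in> S3" "\<And>y. y \<in> S3 \<Longrightarrow> X y = X' y" "\<And>y. y \<in> S3 \<Longrightarrow> Y y = Y' y"
  shows "nabla \<kappa> \<tau> X Y x = nabla \<kappa> \<tau> X' Y' x"
proof -
  have 1: "dir_deriv (\<lambda>y. berger_metric \<kappa> \<tau> y (X y) (Z y)) x v = dir_deriv (\<lambda>y. berger_metric \<kappa> \<tau> y (X' y) (Z y)) x v"
    "dir_deriv (\<lambda>y. berger_metric \<kappa> \<tau> y (Y y) (Z y)) x v = dir_deriv (\<lambda>y. berger_metric \<kappa> \<tau> y (Y' y) (Z y)) x v"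
    "dir_deriv (\<lambda>y. berger_metric \<kappa> \<tau> y (X y) (Y y)) x v = dir_deriv (\<lambda>y. berger_metric \<kappa> \<tau> y (X' y) (Y' y)) x v" for Z v
    by (rule dir_deriv_cong[OF assms(1)], simp only: assms(2,3))+
  have 2: "vf_bracket X Y x = vf_bracket X' Y' x" "vf_bracket X Z x = vf_bracket X' Z x"
    "vf_bracket Y Z x = vf_bracket Y' Z x" for Z
    by (rule vf_bracket_cong[OF assms(1)], simp_all only: assms(2,3))+
  have "koszul \<kappa> \<tau> X Y Z x = koszul \<kappa> \<tau> X' Y' Z x" for Z
    unfolding koszul_def Let_def 1(3) 2(1) unfolding 1(1,2) 2(2,3) assms(2,3)[OF assms(1)] ..
  then show ?thesis by (simp add: nabla_def)
qed

lemma qmult_distrib [simp]: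
  "x \<odot> (\<xi> + \<eta>) = x \<odot> \<xi> + x \<odot> \<eta>" "x \<odot> (\<xi> - \<eta>) = x \<odot> \<xi> - x \<odot> \<eta>" "x \<odot> (c *\<^sub>R \<xi>) = c *\<^sub>R (x \<odot> \<xi>)"
  "(\<xi> + \<eta>) \<odot> x = \<xi> \<odot> x + \<eta> \<odot> x" "(\<xi> - \<eta>) \<odot> x = \<xi> \<odot> x - \<eta> \<odot> x" "(c *\<^sub>R \<xi>) \<odot> x = c *\<^sub>R (\<xi> \<odot> x)"
  by (simp_all add: quat_eq_iff qmult_def algebra_simps)

lemma bounded_bilinear_qmult: "bounded_bilinear (\<odot>)"
  by (simp add: bilinear_conv_bounded_bilinear[symmetric] bilinear_def linear_iff)

lemma qconj_qmult_cancel: "x \<in> S3 \<Longrightarrow> qconj x \<odot> (x \<odot> \<xi>) = \<xi>" "x \<in> S3 \<Longrightarrow> x \<odot> (qconj x \<odot> \<xi>) = \<xi>"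
  by (simp_all add: qmult_assoc[symmetric] qconj_mult_self del: mem_sphere_0)

lemma qconj_qmult_tangent:
  assumes "x \<in> S3" "v \<in> tangent x"
  shows "qconj x \<odot> v \<in> tangent qone"
proof -
  have "(x \<odot> (qconj x \<odot> v)) \<bullet> (x \<odot> qone) = (x \<bullet> x) * ((qconj x \<odot> v) \<bullet> qone)"
    by (rule inner_qmult_left)
  then show ?thesis using assms unfolding qconj_qmult_cancel(2)[OF assms(1)] S3_iff by (simp add: tangent_def)
qed

section \<open>Metric, connection and curvature in frame coordinates\<close>

locale berger =
  fixes \<kappa> \<tau> :: real
  assumes kap_pos: "\<kappa> > 0" and tau_pos: "\<tau> > 0"
begin

text \<open>The structure constant of the two brackets that involve \<open>u\<^sub>3\<close>.
  Writing \<kappa> as \<open>lam * \<tau>\<close> turns the identities below into polynomial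
  ones.\<close>

definition lam :: real where "lam = \<kappa> / \<tau>"

lemma kap_eq: "\<kappa> = lam * \<tau>" using tau_pos by (simp add: lam_def)

lemma lam_pos: "lam > 0" using kap_pos tau_pos by (simp add: lam_def)

definition alg :: "real \<Rightarrow> real \<Rightarrow> real \<Rightarrow> quat" where
  "alg a b c = a *\<^sub>R berger_basis \<kappa> \<tau> 1 + b *\<^sub>R berger_basis \<kappa> \<tau> 2 + c *\<^sub>R berger_basis \<kappa> \<tau> 3"

abbreviation crd :: "nat \<Rightarrow> quat \<Rightarrow> real" where "crd \<equiv> berger_coord \<kappa> \<tau>"

lemma alg_components:
  "Re (fst (alg a b c)) = 0" "Im (fst (alg a b c)) = lam / 2 * c"
  "Re (snd (alg a b c)) = sqrt \<kappa> / 2 * a" "Im (snd (alg a b c)) = sqrt \<kappa> / 2 * b"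
  by (simp_all add: alg_def berger_basis_def lam_def mult.commute)

lemma sum3: "(\<Sum>n\<in>{1..3::nat}. f n) = f 1 + f 2 + (f 3 :: 'z::comm_monoid_add)"
  by (simp add: numeral_eq_Suc atLeastAtMostSuc_conv add.commute add.left_commute)

lemma crd_eq:
  "crd 1 \<xi> = Re (snd \<xi>) * 2 / sqrt \<kappa>" "crd 2 \<xi> = Im (snd \<xi>) * 2 / sqrt \<kappa>" "crd 3 \<xi> = Im (fst \<xi>) * 2 / lam"
  using kap_pos tau_pos by (auto simp: berger_coord_def berger_basis_def inner_quat lam_def power2_eq_square field_simps)

lemma crd_alg: "crd 1 (alg a b c) = a" "crd 2 (alg a b c) = b" "crd 3 (alg a b c) = c"
  using kap_pos lam_pos by (simp_all only: crd_eq alg_components) (simp_all add: field_simps)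

lemma alg_crd:
  assumes "\<xi> \<in> tangent qone"
  shows "alg (crd 1 \<xi>) (crd 2 \<xi>) (crd 3 \<xi>) = \<xi>"
proof -
  have "Re (fst \<xi>) = 0" using assms by (simp add: tangent_def qone_def inner_quat)
  then show ?thesis
    using kap_pos lam_pos by (simp add: quat_eq_iff alg_components crd_eq[unfolded One_nat_def])
qed

lemma alg_eq_iff: "alg a b c = alg a' b' c' \<longleftrightarrow> a = a' \<and> b = b' \<and> c = c'"
  by (metis crd_alg)

lemma alg_eqI: "a = a' \<Longrightarrow> b = b' \<Longrightarrow> c = c' \<Longrightarrow> alg a b c = alg a' b' c'"
  by simp

lemma alg_linear:
  "alg a b c + alg a' b' c' = alg (a + a') (b + b') (c + c')"
  "alg a b c - alg a' b' c' = alg (a - a') (b - b') (c - c')"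
  "k *\<^sub>R alg a b c = alg (k * a) (k * b) (k * c)"
  by (simp_all add: alg_def algebra_simps)

lemma alg_zero: "alg 0 0 0 = 0"
  by (simp add: alg_def)

lemma alg_tangent: "alg a b c \<in> tangent qone"
  by (simp add: tangent_def qone_def inner_quat alg_components)

lemma basis_eq_alg:
  "berger_basis \<kappa> \<tau> 1 = alg 1 0 0" "berger_basis \<kappa> \<tau> 2 = alg 0 1 0" "berger_basis \<kappa> \<tau> 3 = alg 0 0 1"
  by (simp_all add: alg_def)

lemma frame_eq:
  "berger_frame \<kappa> \<tau> 1 = linv (alg 1 0 0)" "berger_frame \<kappa> \<tau> 2 = linv (alg 0 1 0)" "berger_frame \<kappa> \<tau> 3 = linv (alg 0 0 1)"
  by (simp_all only: berger_frame_def basis_eq_alg)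

lemma frame_combination:
  "a *\<^sub>R (x \<odot> alg 1 0 0) + b *\<^sub>R (x \<odot> alg 0 1 0) + c *\<^sub>R (x \<odot> alg 0 0 1) = x \<odot> alg a b c"
  by (simp add: alg_def algebra_simps)

lemma metric_alg:
  assumes "x \<in> S3"
  shows "berger_metric \<kappa> \<tau> x (x \<odot> alg a b c) (x \<odot> alg a' b' c') = a * a' + b * b' + c * c'"
  using assms by (simp only: berger_metric_def sum3 qconj_qmult_cancel crd_alg)

lemma alg_commutator:
  "alg a b c \<odot> alg a' b' c' - alg a' b' c' \<odot> alg a b c
    = alg (lam * (b * c' - c * b')) (lam * (c * a' - a * c')) (\<tau> * (a * b' - b * a'))"
proof -
  \<comment> \<open>The root is made opaque; all that is used about it is the value of its
    square.\<close>
  obtain k where k: "sqrt \<kappa> = k" by blast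
  have kk: "k * k = lam * \<tau>" using kap_pos kap_eq k by auto
  show ?thesis
    by (simp add: quat_eq_iff alg_components qmult_def k) (simp add: algebra_simps kk)
qed

lemma vf_bracket_alg:
  assumes "x \<in> S3"
  shows "vf_bracket (linv (alg a b c)) (linv (alg a' b' c')) x
    = linv (alg (lam * (b * c' - c * b')) (lam * (c * a' - a * c')) (\<tau> * (a * b' - b * a'))) x"
  using assms by (simp only: vf_bracket_linv alg_tangent alg_commutator)

text \<open>Inner products of left-invariant fields are constant, so the three derivative terms
  vanish and only the brackets contribute.\<close>

lemma koszul_alg:
  assumes "x \<in> S3"
  shows "koszul \<kappa> \<tau> (linv (alg a b c)) (linv (alg a' b' c')) (linv (alg a'' b'' c'')) x =
      (lam * (b * c' - c * b')) * a'' + (lam * (c * a' - a * c')) * b'' + (\<tau> * (a * b' - b * a')) * c''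
    - ((lam * (b * c'' - c * b'')) * a' + (lam * (c * a'' - a * c'')) * b' + (\<tau> * (a * b'' - b * a'')) * c')
    - ((lam * (b' * c'' - c' * b'')) * a + (lam * (c' * a'' - a' * c'')) * b + (\<tau> * (a' * b'' - b' * a'')) * c)"
proof -
  have 0: "dir_deriv (\<lambda>y. berger_metric \<kappa> \<tau> y (y \<odot> alg a b c) (y \<odot> alg a' b' c')) x v = 0" for a b c a' b' c' v
    using assms by (intro dir_deriv_const[where c = "a * a' + b * b' + c * c'"]) (auto simp only: metric_alg)
  show ?thesis
    unfolding koszul_def Let_def vf_bracket_alg[OF assms] unfolding linv_def unfolding 0 metric_alg[OF assms]
    by simp
qed

text \<open>The Koszul expression is read off against the three frame fields. For instance the
  derivative of \<open>u\<^sub>2\<close> along \<open>u\<^sub>1\<close> is \<open>\<tau> / 2\<close>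
  times \<open>u\<^sub>3\<close>, and that of \<open>u\<^sub>1\<close> along
  \<open>u\<^sub>3\<close> is \<open>lam - \<tau> / 2\<close> times
  \<open>u\<^sub>2\<close>.\<close>

lemma nabla_alg:
  assumes "x \<in> S3"
  shows "nabla \<kappa> \<tau> (linv (alg a b c)) (linv (alg a' b' c')) x
    = x \<odot> alg (\<tau> / 2 * b * c' - (lam - \<tau> / 2) * c * b') ((lam - \<tau> / 2) * c * a' - \<tau> / 2 * a * c')
        (\<tau> / 2 * (a * b' - b * a'))"
  unfolding nabla_def sum3 frame_eq koszul_alg[OF assms] unfolding linv_def frame_combination
  by (intro arg_cong[where f = "(\<odot>) x"] alg_eqI) (simp_all add: field_simps)

text \<open>The Jacobi operator of a metric whose sectional curvature is
  \<open>\<kappa> - 3 * (\<tau> / 2)\<^sup>2\<close> on horizontal planes and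
  \<open>(\<tau> / 2)\<^sup>2\<close> on planes containing \<open>u\<^sub>3\<close>.\<close>

lemma curvature_alg:
  assumes x: "x \<in> S3"
  shows "curvature \<kappa> \<tau> x (x \<odot> alg p q r) (x \<odot> alg a b c) (x \<odot> alg a b c)
    = x \<odot> alg ((\<tau> / 2)\<^sup>2 * c * (p * c - r * a) + (\<kappa> - 3 * (\<tau> / 2)\<^sup>2) * b * (p * b - q * a))
              ((\<tau> / 2)\<^sup>2 * c * (q * c - r * b) + (\<kappa> - 3 * (\<tau> / 2)\<^sup>2) * a * (q * a - p * b))
              ((\<tau> / 2)\<^sup>2 * (a * (r * a - p * c) + b * (r * b - q * c)))"
proof -
  obtain L where L: "lam = L" by blast
  then have kL: "\<kappa> = L * \<tau>" using kap_eq by simp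
  have 2: "nabla \<kappa> \<tau> X (nabla \<kappa> \<tau> (linv (alg a b c)) (linv (alg a' b' c'))) x
    = nabla \<kappa> \<tau> X (linv (alg (\<tau> / 2 * b * c' - (lam - \<tau> / 2) * c * b') ((lam - \<tau> / 2) * c * a' - \<tau> / 2 * a * c')
        (\<tau> / 2 * (a * b' - b * a')))) x" for X a b c a' b' c'
    by (rule nabla_cong[OF x refl]) (simp only: nabla_alg, simp only: linv_def)
  have 3: "nabla \<kappa> \<tau> (vf_bracket (linv (alg a b c)) (linv (alg a' b' c'))) Z x
    = nabla \<kappa> \<tau> (linv (alg (lam * (b * c' - c * b')) (lam * (c * a' - a * c')) (\<tau> * (a * b' - b * a')))) Z x" for Z a b c a' b' c'
    by (rule nabla_cong[OF x]) (simp_all only: vf_bracket_alg)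
  show ?thesis
    unfolding curvature_def curvature_vf_def linv_ext_def qconj_qmult_cancel(1)[OF x] 2 3 nabla_alg[OF x]
      qmult_distrib(2)[symmetric] alg_linear
    by (intro arg_cong[where f = "(\<odot>) x"] alg_eqI)
      (simp_all only: L, simp_all add: kL power2_eq_square field_simps)
qed

text \<open>Leibniz rule over the frame: the coordinates are differentiated and
  \<open>nabla_alg\<close> supplies the derivatives of the frame fields.\<close>

lemma cov_deriv_alg:
  assumes \<gamma>: "\<And>s. \<gamma> s \<in> S3" and V: "\<And>s. V s = \<gamma> s \<odot> alg (p s) (q s) (r s)"
    and v: "velocity \<gamma> t = \<gamma> t \<odot> alg a b c"
    and d: "(p has_real_derivative p') (at t)" "(q has_real_derivative q') (at t)" "(r has_real_derivative r') (at t)"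
  shows "cov_deriv \<kappa> \<tau> \<gamma> V t = \<gamma> t \<odot> alg
    (p' + \<tau> / 2 * b * r t - (lam - \<tau> / 2) * c * q t)
    (q' + (lam - \<tau> / 2) * c * p t - \<tau> / 2 * a * r t)
    (r' + \<tau> / 2 * (a * q t - b * p t))"
proof -
  have "cov_deriv \<kappa> \<tau> \<gamma> V t =
     p' *\<^sub>R (\<gamma> t \<odot> alg 1 0 0) + p t *\<^sub>R nabla \<kappa> \<tau> (linv (alg a b c)) (linv (alg 1 0 0)) (\<gamma> t)
     + (q' *\<^sub>R (\<gamma> t \<odot> alg 0 1 0) + q t *\<^sub>R nabla \<kappa> \<tau> (linv (alg a b c)) (linv (alg 0 1 0)) (\<gamma> t))
     + (r' *\<^sub>R (\<gamma> t \<odot> alg 0 0 1) + r t *\<^sub>R nabla \<kappa> \<tau> (linv (alg a b c)) (linv (alg 0 0 1)) (\<gamma> t))"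
    unfolding cov_deriv_def sum3 frame_eq linv_ext_def v qconj_qmult_cancel(1)[OF \<gamma>] V
    unfolding linv_def metric_alg[OF \<gamma>]
    using d[THEN DERIV_imp_deriv] by simp
  also have "\<dots> = \<gamma> t \<odot> alg
    (p' + \<tau> / 2 * b * r t - (lam - \<tau> / 2) * c * q t)
    (q' + (lam - \<tau> / 2) * c * p t - \<tau> / 2 * a * r t)
    (r' + \<tau> / 2 * (a * q t - b * p t))"
    unfolding nabla_alg[OF \<gamma>] qmult_distrib(1,3)[symmetric] alg_linear
    by (intro arg_cong[where f = "(\<odot>) (\<gamma> t)"] alg_eqI) (simp_all add: algebra_simps)
  finally show ?thesis .
qed

end


section \<open>Killing fields\<close>

text \<open>The left-invariant field is extended linearly to all quaternions, so functions are
  differentiated on an open set of a vector space, where second derivatives commute.\<close>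

definition lie :: "quat \<Rightarrow> (quat \<Rightarrow> real) \<Rightarrow> quat \<Rightarrow> real" where
  "lie \<xi> F x = frechet_derivative F (at x) (x \<odot> \<xi>)"

lemma sgn_S3: "x \<in> S3 \<Longrightarrow> sgn x = x"
  by (simp add: sgn_div_norm)

lemma open_punctured: "open (- {0 :: quat})"
  by (rule open_Compl) simp

lemma frechet_derivative_euclidean:
  fixes F :: "quat \<Rightarrow> real"
  assumes "smooth_on (- {0}) F" "x \<noteq> 0"
  shows "frechet_derivative F (at x) v = (\<Sum>b\<in>Basis. (v \<bullet> b) * frechet_derivative F (at x) b)"
proof -
  have "(F has_derivative frechet_derivative F (at x)) (at x)"
    using assms by (intro smooth_on_imp_has_derivative[OF _ open_punctured]) auto
  then have L: "linear (frechet_derivative F (at x))" by (rule has_derivative_linear)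
  have "frechet_derivative F (at x) v = frechet_derivative F (at x) (\<Sum>b\<in>Basis. (v \<bullet> b) *\<^sub>R b)"
    by (simp only: euclidean_representation)
  also have "\<dots> = (\<Sum>b\<in>Basis. (v \<bullet> b) * frechet_derivative F (at x) b)"
    by (simp only: linear_sum[OF L] linear_scale[OF L] real_scaleR_def)
  finally show ?thesis .
qed

lemma lie_euclidean:
  assumes "smooth_on (- {0}) F" "x \<noteq> 0"
  shows "lie \<xi> F x = (\<Sum>b\<in>Basis. ((x \<odot> \<xi>) \<bullet> b) * frechet_derivative F (at x) b)"
  unfolding lie_def by (rule frechet_derivative_euclidean[OF assms])

lemma bounded_linear_qmult_inner: "bounded_linear (\<lambda>x. (x \<odot> \<xi>) \<bullet> b)"
  by (rule bounded_linear_compose[OF bounded_linear_inner_left bounded_bilinear.bounded_linear_left[OF bounded_bilinear_qmult]])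

lemma smooth_on_lie:
  assumes "smooth_on (- {0}) F"
  shows "smooth_on (- {0}) (lie \<xi> F)"
proof -
  have "smooth_on (- {0}) (\<lambda>x. \<Sum>b\<in>Basis. ((x \<odot> \<xi>) \<bullet> b) * frechet_derivative F (at x) b)"
    by (intro smooth_on_sum smooth_on_bilinear[OF _ bounded_bilinear_mult] open_punctured
        smooth_on_bounded_linear[OF _ bounded_linear_qmult_inner] smooth_on_id smooth_on_frechet_derivative assms)
  then show ?thesis
    by (rule smooth_on_cong[OF open_punctured, THEN iffD1, rotated]) (simp add: lie_euclidean[OF assms])
qed

lemma lie_cong:
  assumes "smooth_on (- {0}) F" "\<And>y. y \<noteq> 0 \<Longrightarrow> F y = G y" "x \<noteq> 0"
  shows "lie \<xi> F x = lie \<xi> G x"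
proof -
  have "F differentiable at x"
    using smooth_on_imp_has_derivative[OF assms(1) open_punctured] assms(3)
    by (meson ComplI differentiable_def singletonD)
  then have "frechet_derivative F (at x) = frechet_derivative G (at x)"
    using assms(2,3) by (intro frechet_derivative_transform_within_open[OF _ open_punctured]) auto
  then show ?thesis by (simp add: lie_def)
qed

lemma lie_lincomb:
  assumes "smooth_on (- {0}) F" "smooth_on (- {0}) G" "x \<noteq> 0"
  shows "lie \<xi> (\<lambda>y. a * F y + b * G y) x = a * lie \<xi> F x + b * lie \<xi> G x"
proof -
  have "((\<lambda>y. a * F y + b * G y) has_derivative
      (\<lambda>v. a * frechet_derivative F (at x) v + b * frechet_derivative G (at x) v)) (at x)"
    using assms by (intro has_derivative_add has_derivative_mult_right
        smooth_on_imp_has_derivative[OF _ open_punctured]) auto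
  then show ?thesis by (simp add: lie_def frechet_derivative_at[symmetric])
qed

lemma lie_const: "lie \<xi> (\<lambda>_. c) x = 0"
  by (simp add: lie_def)

lemma lie_linear:
  assumes "smooth_on (- {0}) F" "x \<noteq> 0"
  shows "lie (a *\<^sub>R \<xi>) F x = a * lie \<xi> F x" "lie (\<xi> + \<eta>) F x = lie \<xi> F x + lie \<eta> F x"
  unfolding lie_euclidean[OF assms]
  by (simp_all add: inner_add_left distrib_right sum.distrib sum_distrib_left mult.assoc)

text \<open>The second-order terms cancel by symmetry of second derivatives; the first-order terms
  combine through associativity of the product.\<close>

lemma lie_commutator:
  assumes F: "smooth_on (- {0}) F" and x: "x \<noteq> 0"
  shows "lie \<xi> (lie \<eta> F) x - lie \<eta> (lie \<xi> F) x = lie (\<xi> \<odot> \<eta> - \<eta> \<odot> \<xi>) F x"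
proof -
  let ?d = "\<lambda>b y. frechet_derivative F (at y) b"
  let ?H = "\<Sum>b\<in>Basis. \<Sum>c\<in>Basis. ((x \<odot> \<eta>) \<bullet> b) * (((x \<odot> \<xi>) \<bullet> c) * frechet_derivative (?d b) (at x) c)"
  have x': "x \<in> - {0}" using x by simp
  have sm: "smooth_on (- {0}) (?d b)" for b by (rule smooth_on_frechet_derivative[OF F])
  \<comment> \<open>The first-order term comes from differentiating the linear coefficient
    \<open>x \<odot> \<eta>\<close> in the direction \<open>x \<odot> \<xi>\<close>, the double sum
    from differentiating the partial derivatives of \<open>F\<close>.\<close>
  have step: "lie \<xi> (lie \<eta> F) x = lie (\<xi> \<odot> \<eta>) F x
     + (\<Sum>b\<in>Basis. \<Sum>c\<in>Basis. ((x \<odot> \<eta>) \<bullet> b) * (((x \<odot> \<xi>) \<bullet> c) * frechet_derivative (?d b) (at x) c))" for \<xi> \<eta>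
  proof -
    have "((\<lambda>y. \<Sum>b\<in>Basis. ((y \<odot> \<eta>) \<bullet> b) * ?d b y) has_derivative
        (\<lambda>v. \<Sum>b\<in>Basis. ((x \<odot> \<eta>) \<bullet> b) * frechet_derivative (?d b) (at x) v + ((v \<odot> \<eta>) \<bullet> b) * ?d b x)) (at x)"
      by (intro has_derivative_sum has_derivative_mult bounded_linear_imp_has_derivative[OF bounded_linear_qmult_inner]
          smooth_on_imp_has_derivative[OF sm open_punctured x'])
    then have "lie \<xi> (\<lambda>y. \<Sum>b\<in>Basis. ((y \<odot> \<eta>) \<bullet> b) * ?d b y) x =
        (\<Sum>b\<in>Basis. ((x \<odot> \<eta>) \<bullet> b) * frechet_derivative (?d b) (at x) (x \<odot> \<xi>) + ((x \<odot> \<xi> \<odot> \<eta>) \<bullet> b) * ?d b x)"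
      by (simp only: lie_def frechet_derivative_at[symmetric])
    moreover have "lie \<xi> (lie \<eta> F) x = lie \<xi> (\<lambda>y. \<Sum>b\<in>Basis. ((y \<odot> \<eta>) \<bullet> b) * ?d b y) x"
      by (rule lie_cong[OF smooth_on_lie[OF F] lie_euclidean[OF F] x])
    ultimately show ?thesis
      by (simp only: sum.distrib qmult_assoc lie_euclidean[OF F x] frechet_derivative_euclidean[OF sm x, of _ "x \<odot> \<xi>"]
          sum_distrib_left add.commute)
  qed
  have "(\<Sum>b\<in>Basis. \<Sum>c\<in>Basis. ((x \<odot> \<xi>) \<bullet> b) * (((x \<odot> \<eta>) \<bullet> c) * frechet_derivative (?d b) (at x) c)) = ?H"
    by (subst sum.swap, intro sum.cong refl)
       (simp only: frechet_derivative_commute[OF F open_punctured x', of _ _] mult.left_commute)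
  then have "lie \<xi> (lie \<eta> F) x - lie \<eta> (lie \<xi> F) x = lie (\<xi> \<odot> \<eta>) F x - lie (\<eta> \<odot> \<xi>) F x"
    unfolding step by simp
  also have "\<dots> = lie (\<xi> \<odot> \<eta> - \<eta> \<odot> \<xi>) F x"
    unfolding lie_euclidean[OF F x] by (simp add: inner_diff_left left_diff_distrib sum_subtractf)
  finally show ?thesis .
qed

definition homogeneous :: "(quat \<Rightarrow> real) \<Rightarrow> bool" where
  "homogeneous F \<longleftrightarrow> (\<forall>x c. x \<noteq> 0 \<longrightarrow> c > 0 \<longrightarrow> F (c *\<^sub>R x) = F x)"

text \<open>The field \<open>x \<odot> \<xi>\<close> scales like \<open>x\<close>, so along it the
  derivative of a function constant on rays is again constant on rays. This carries the Killing
  equations from the sphere to an open set, where they can be differentiated.\<close>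

lemma lie_sgn:
  assumes F: "smooth_on (- {0}) F" and h: "homogeneous F" and x: "x \<noteq> 0"
  shows "lie \<xi> F (sgn x) = lie \<xi> F x"
proof -
  define c where "c = inverse (norm x)"
  have c: "c > 0" "sgn x = c *\<^sub>R x" using x by (auto simp: c_def sgn_div_norm)
  let ?D = "frechet_derivative F (at (c *\<^sub>R x))"
  have D: "(F has_derivative ?D) (at (c *\<^sub>R x))"
    using c x by (intro smooth_on_imp_has_derivative[OF F open_punctured]) auto
  have "((\<lambda>y. F (c *\<^sub>R y)) has_derivative (\<lambda>v. ?D (c *\<^sub>R v))) (at x)"
    by (rule has_derivative_compose[of "\<lambda>y. c *\<^sub>R y" "\<lambda>v. c *\<^sub>R v" x UNIV F, OF _ D])
      (auto intro!: derivative_eq_intros)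
  then have "(F has_derivative (\<lambda>v. ?D (c *\<^sub>R v))) (at x)"
    by (rule has_derivative_transform_within_open[OF _ open_punctured])
      (use x h c in \<open>auto simp: homogeneous_def simp del: split_paired_All\<close>)
  then have "frechet_derivative F (at x) = (\<lambda>v. ?D (c *\<^sub>R v))"
    by (rule frechet_derivative_at[symmetric])
  then show ?thesis by (simp add: lie_def c)
qed

section \<open>Frame components of Killing fields\<close>

context berger
begin

lemma lie_alg:
  assumes "smooth_on (- {0}) F" "x \<noteq> 0"
  shows "lie (alg a b c) F x = a * lie (alg 1 0 0) F x + b * lie (alg 0 1 0) F x + c * lie (alg 0 0 1) F x"
proof -
  have "alg a b c = a *\<^sub>R alg 1 0 0 + b *\<^sub>R alg 0 1 0 + c *\<^sub>R alg 0 0 1" by (simp add: alg_linear)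
  then show ?thesis by (simp only: lie_linear[OF assms])
qed

lemma lie_alg_commutators:
  assumes "smooth_on (- {0}) F" "x \<noteq> 0"
  shows "lie (alg 1 0 0) (lie (alg 0 1 0) F) x - lie (alg 0 1 0) (lie (alg 1 0 0) F) x = \<tau> * lie (alg 0 0 1) F x"
    "lie (alg 0 1 0) (lie (alg 0 0 1) F) x - lie (alg 0 0 1) (lie (alg 0 1 0) F) x = lam * lie (alg 1 0 0) F x"
    "lie (alg 0 0 1) (lie (alg 1 0 0) F) x - lie (alg 1 0 0) (lie (alg 0 0 1) F) x = lam * lie (alg 0 1 0) F x"
  unfolding lie_commutator[OF assms] alg_commutator
  by (subst lie_alg[OF assms], simp)+

lemma vector_field_alg: "vector_field (linv (alg a b c))"
proof -
  have "smooth_on (- {0}) (\<lambda>x. sgn x \<odot> alg a b c)"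
    by (rule smooth_on_bilinear[OF open_punctured bounded_bilinear_qmult smooth_on_sgn smooth_on_const])
  then show ?thesis
    by (auto simp: vector_field_def smooth_S3_def comp_def linv_def
        linv_tangent[OF _ alg_tangent, unfolded linv_def] simp del: mem_sphere_0)
qed

text \<open>Coordinate of the field in the left-invariant frame, extended constantly along rays so
  that \<open>lie\<close> applies to it.\<close>

definition component :: "(quat \<Rightarrow> quat) \<Rightarrow> nat \<Rightarrow> quat \<Rightarrow> real" where
  "component X n x = crd n (qconj (sgn x) \<odot> X (sgn x))"

lemma component_homogeneous: "homogeneous (component X n)"
  by (simp add: homogeneous_def component_def sgn_scaleR)

lemma component_smooth:
  assumes "vector_field X"
  shows "smooth_on (- {0}) (component X n)"
proof -
  have "bounded_linear qconj"
    by (simp add: linear_conv_bounded_linear[symmetric] linear_iff qconj_def)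
  then have c: "smooth_on (- {0}) (\<lambda>x. qconj (sgn x))"
    by (rule smooth_on_bounded_linear[OF open_punctured _ smooth_on_sgn])
  have "bounded_linear (crd n)"
    unfolding berger_coord_def divide_inverse
    by (rule bounded_linear_compose[OF bounded_linear_mult_left bounded_linear_inner_left])
  moreover have "smooth_on (- {0}) (\<lambda>x. X (sgn x))"
    using assms by (simp add: vector_field_def smooth_S3_def comp_def)
  ultimately show ?thesis unfolding component_def
    by (intro smooth_on_bounded_linear[OF open_punctured _ smooth_on_bilinear[OF open_punctured bounded_bilinear_qmult c]])
qed

lemma vector_field_components:
  assumes "vector_field X" "x \<in> S3"
  shows "X x = x \<odot> alg (component X 1 x) (component X 2 x) (component X 3 x)"
proof -
  have s: "sgn x = x" using assms(2) by (auto simp: sgn_div_norm)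
  have "qconj x \<odot> X x \<in> tangent qone"
    using assms by (intro qconj_qmult_tangent) (auto simp: vector_field_def)
  then show ?thesis
    unfolding component_def s by (simp only: alg_crd qconj_qmult_cancel assms(2))
qed

text \<open>The algebra commutator comes from treating the components as constants; the remaining
  terms are their derivatives along the left-invariant field.\<close>

lemma vf_bracket_components:
  assumes X: "vector_field X" and x: "x \<in> S3"
  shows "vf_bracket X (linv (alg a b c)) x = x \<odot> alg
     (lam * (component X 2 x * c - component X 3 x * b) - lie (alg a b c) (component X 1) x)
     (lam * (component X 3 x * a - component X 1 x * c) - lie (alg a b c) (component X 2) x)
     (\<tau> * (component X 1 x * b - component X 2 x * a) - lie (alg a b c) (component X 3) x)"
proof -
  let ?f = "component X"
  let ?D = "\<lambda>n. frechet_derivative (?f n) (at x)"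
  let ?\<xi> = "alg a b c"
  have x0: "x \<noteq> 0" and s: "sgn x = x" using x by (auto simp: sgn_div_norm)
  have D: "(?f n has_derivative ?D n) (at x)" for n
    using x0 by (intro smooth_on_imp_has_derivative[OF component_smooth[OF X] open_punctured]) auto
  have "((\<lambda>y. alg (?f 1 y) (?f 2 y) (?f 3 y)) has_derivative (\<lambda>v. alg (?D 1 v) (?D 2 v) (?D 3 v))) (at x)"
    unfolding alg_def by (intro has_derivative_add has_derivative_scaleR_left D)
  from bounded_bilinear.FDERIV[OF bounded_bilinear_qmult has_derivative_sgn_S3[OF x] this]
  have "((\<lambda>y. sgn y \<odot> alg (?f 1 y) (?f 2 y) (?f 3 y)) has_derivative
      (\<lambda>v. x \<odot> alg (?D 1 v) (?D 2 v) (?D 3 v) + (v - (v \<bullet> x) *\<^sub>R x) \<odot> alg (?f 1 x) (?f 2 x) (?f 3 x))) (at x)"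
    unfolding s .
  then have "(X \<circ> sgn has_derivative
      (\<lambda>v. x \<odot> alg (?D 1 v) (?D 2 v) (?D 3 v) + (v - (v \<bullet> x) *\<^sub>R x) \<odot> alg (?f 1 x) (?f 2 x) (?f 3 x))) (at x)"
  proof (rule has_derivative_transform_within_open[OF _ open_punctured])
    show "x \<in> - {0}" using x0 by simp
    fix y :: quat assume "y \<in> - {0}"
    then have "sgn y \<in> S3" "sgn (sgn y) = sgn y" by (simp add: norm_sgn, simp add: sgn_S3 norm_sgn)
    then show "sgn y \<odot> alg (?f 1 y) (?f 2 y) (?f 3 y) = (X \<circ> sgn) y"
      using vector_field_components[OF X, of "sgn y"] by (simp add: component_def)
  qed
  then have "dir_deriv X x (x \<odot> ?\<xi>) = x \<odot> alg (?D 1 (x \<odot> ?\<xi>)) (?D 2 (x \<odot> ?\<xi>)) (?D 3 (x \<odot> ?\<xi>))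
      + (x \<odot> ?\<xi> - ((x \<odot> ?\<xi>) \<bullet> x) *\<^sub>R x) \<odot> alg (?f 1 x) (?f 2 x) (?f 3 x)"
    unfolding dir_deriv_def by (simp only: frechet_derivative_at[symmetric])
  \<comment> \<open>The direction is tangent, so the projection in the derivative of
    \<open>sgn\<close> fixes it.\<close>
  moreover have "(x \<odot> ?\<xi>) \<bullet> x = 0"
    using linv_tangent[OF x alg_tangent] by (simp add: linv_def tangent_def)
  ultimately have 1: "dir_deriv X x (x \<odot> ?\<xi>) = x \<odot> (alg (lie ?\<xi> (?f 1) x) (lie ?\<xi> (?f 2) x) (lie ?\<xi> (?f 3) x)
      + ?\<xi> \<odot> alg (?f 1 x) (?f 2 x) (?f 3 x))"
    by (simp add: lie_def qmult_assoc)
  have "X x \<in> tangent x" using X x by (auto simp: vector_field_def)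
  then have 2: "dir_deriv (linv ?\<xi>) x (X x) = x \<odot> (alg (?f 1 x) (?f 2 x) (?f 3 x) \<odot> ?\<xi>)"
    using vector_field_components[OF X x] by (simp only: dir_deriv_linv[OF x] qmult_assoc[symmetric])
  have "vf_bracket X (linv ?\<xi>) x = x \<odot> ((alg (?f 1 x) (?f 2 x) (?f 3 x) \<odot> ?\<xi> - ?\<xi> \<odot> alg (?f 1 x) (?f 2 x) (?f 3 x))
     - alg (lie ?\<xi> (?f 1) x) (lie ?\<xi> (?f 2) x) (lie ?\<xi> (?f 3) x))"
    unfolding vf_bracket_def 2 unfolding linv_def 1 by simp
  then show ?thesis unfolding alg_commutator alg_linear .
qed

text \<open>The Killing condition tested on two left-invariant fields: their inner product is
  constant, and only the two bracket terms survive.\<close>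

lemma killing_equation_S3:
  assumes K: "killing_field \<kappa> \<tau> X" and x: "x \<in> S3"
  shows
    "(lam * (component X 2 x * c - component X 3 x * b) - lie (alg a b c) (component X 1) x) * a'
     + (lam * (component X 3 x * a - component X 1 x * c) - lie (alg a b c) (component X 2) x) * b'
     + (\<tau> * (component X 1 x * b - component X 2 x * a) - lie (alg a b c) (component X 3) x) * c'
     + ((lam * (component X 2 x * c' - component X 3 x * b') - lie (alg a' b' c') (component X 1) x) * a
     + (lam * (component X 3 x * a' - component X 1 x * c') - lie (alg a' b' c') (component X 2) x) * b
     + (\<tau> * (component X 1 x * b' - component X 2 x * a') - lie (alg a' b' c') (component X 3) x) * c) = 0"
proof -
  have X: "vector_field X" using K by (simp add: killing_field_def)
  have "lie_deriv_metric \<kappa> \<tau> X (linv (alg a b c)) (linv (alg a' b' c')) x = 0"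
    using K x vector_field_alg by (auto simp: killing_field_def)
  moreover have "dir_deriv (\<lambda>y. berger_metric \<kappa> \<tau> y (y \<odot> alg a b c) (y \<odot> alg a' b' c')) x v = 0" for v
    using x by (intro dir_deriv_const[where c = "a * a' + b * b' + c * c'"]) (auto simp only: metric_alg)
  ultimately show ?thesis
    unfolding lie_deriv_metric_def vf_bracket_components[OF X x] unfolding linv_def metric_alg[OF x]
    by (simp add: mult.commute del: One_nat_def)
qed

text \<open>One equation for each unordered pair of frame fields, moved from \<open>sgn x\<close> to
  \<open>x\<close> by invariance along rays.\<close>

lemma killing_equation:
  assumes K: "killing_field \<kappa> \<tau> X" and x: "x \<noteq> 0"
  shows
    "lie (alg 1 0 0) (component X 1) x = 0" "lie (alg 0 1 0) (component X 2) x = 0"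
    "lie (alg 0 0 1) (component X 3) x = 0"
    "lie (alg 0 1 0) (component X 1) x = - lie (alg 1 0 0) (component X 2) x"
    "lie (alg 1 0 0) (component X 3) x = (lam - \<tau>) * component X 2 x - lie (alg 0 0 1) (component X 1) x"
    "lie (alg 0 1 0) (component X 3) x = (\<tau> - lam) * component X 1 x - lie (alg 0 0 1) (component X 2) x"
proof -
  have X: "vector_field X" using K by (simp add: killing_field_def)
  have s: "sgn x \<in> S3" using x by (simp add: norm_sgn)
  have c: "component X n (sgn x) = component X n x" for n
    using s by (simp add: component_def sgn_S3)
  note E = killing_equation_S3[OF K s, unfolded lie_sgn[OF component_smooth[OF X] component_homogeneous x] c]
  show "lie (alg 1 0 0) (component X 1) x = 0" using E[where a=1 and b=0 and c=0 and a'=1 and b'=0 and c'=0] by simp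
  show "lie (alg 0 1 0) (component X 2) x = 0" using E[where a=0 and b=1 and c=0 and a'=0 and b'=1 and c'=0] by simp
  show "lie (alg 0 0 1) (component X 3) x = 0" using E[where a=0 and b=0 and c=1 and a'=0 and b'=0 and c'=1] by simp
  show "lie (alg 0 1 0) (component X 1) x = - lie (alg 1 0 0) (component X 2) x"
    using E[where a=1 and b=0 and c=0 and a'=0 and b'=1 and c'=0] by (simp add: algebra_simps)
  show "lie (alg 1 0 0) (component X 3) x = (lam - \<tau>) * component X 2 x - lie (alg 0 0 1) (component X 1) x"
    using E[where a=1 and b=0 and c=0 and a'=0 and b'=0 and c'=1] by (simp add: algebra_simps)
  show "lie (alg 0 1 0) (component X 3) x = (\<tau> - lam) * component X 1 x - lie (alg 0 0 1) (component X 2) x"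
    using E[where a=0 and b=1 and c=0 and a'=0 and b'=0 and c'=1] by (simp add: algebra_simps)
qed

text \<open>The first-order Killing equations close up: differentiating them with the commutators of the
  frame determines the vertical derivatives of the horizontal components, because \<open>\<kappa> \<noteq> \<tau>\<^sup>2\<close>.
  The components together with \<open>u\<^sub>1 f\<^sub>2\<close> then satisfy a first-order linear system.\<close>

lemma killing_system:
  assumes K: "killing_field \<kappa> \<tau> X" and ne: "lam \<noteq> \<tau>" and x: "x \<noteq> 0"
  defines "f \<equiv> component X" and "p \<equiv> lie (alg 1 0 0) (component X 2)"
  shows "lie (alg 0 0 1) (f 1) x = lam * f 2 x" "lie (alg 0 0 1) (f 2) x = - lam * f 1 x"
    "lie (alg 1 0 0) p x = - \<tau> * lam * f 2 x" "lie (alg 0 1 0) p x = \<tau> * lam * f 1 x" "lie (alg 0 0 1) p x = 0"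
proof -
  have X: "vector_field X" using K by (simp add: killing_field_def)
  let ?D1 = "lie (alg 1 0 0)" and ?D2 = "lie (alg 0 1 0)" and ?D3 = "lie (alg 0 0 1)"
  \<comment> \<open>\<open>A\<close> and \<open>B\<close> are the unknown vertical derivatives of
    the horizontal components.\<close>
  define A where "A = ?D3 (f 1)"
  define B where "B = ?D3 (f 2)"
  define \<sigma> where "\<sigma> = lam - \<tau>"
  have \<sigma>: "\<sigma> \<noteq> 0" using ne by (simp add: \<sigma>_def)
  have sf: "smooth_on (- {0}) (f n)" for n unfolding f_def by (rule component_smooth[OF X])
  have sp: "smooth_on (- {0}) p" and sA: "smooth_on (- {0}) A" and sB: "smooth_on (- {0}) B"
    unfolding p_def A_def B_def f_def[symmetric] by (rule smooth_on_lie[OF sf])+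
  have lc: "lie \<xi> G y = a * lie \<xi> F y + b * lie \<xi> H y"
    if "smooth_on (- {0}) G" "\<And>y. y \<noteq> 0 \<Longrightarrow> G y = a * F y + b * H y"
      "smooth_on (- {0}) F" "smooth_on (- {0}) H" "y \<noteq> 0" for \<xi> G F H a b y
    using lie_cong[OF that(1), of "\<lambda>y. a * F y + b * H y"] that lie_lincomb[of F H y] by simp
  have l0: "lie \<xi> G y = 0" if "smooth_on (- {0}) G" "\<And>y. y \<noteq> 0 \<Longrightarrow> G y = 0" "y \<noteq> 0" for \<xi> G y
    using lie_cong[OF that(1), of "\<lambda>_. 0"] that lie_const by simp
  note k = killing_equation[OF K, folded f_def]
  note sl = smooth_on_lie[OF sf] smooth_on_lie[OF sp]
  \<comment> \<open>The Killing equations are padded to combinations of two functions so that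
    \<open>lc\<close> can differentiate them.\<close>
  have k4: "?D2 (f 1) y = (-1) * p y + 0 * p y" and k5: "?D1 (f 3) y = \<sigma> * f 2 y + (-1) * A y"
    and k6: "?D2 (f 3) y = (- \<sigma>) * f 1 y + (-1) * B y" if "y \<noteq> 0" for y
    using k(4-6)[OF that] by (simp_all add: p_def f_def[symmetric] A_def B_def \<sigma>_def algebra_simps)
  have D1p: "?D1 p y = - \<tau> * A y" if "y \<noteq> 0" for y
    using lie_alg_commutators(1)[OF sf that, of 1] lc[OF sl(1) k4 sp sp that] l0[OF sl(1) k(1) that]
    by (simp add: A_def)
  have D2p: "?D2 p y = - \<tau> * B y" if "y \<noteq> 0" for y
    using lie_alg_commutators(1)[OF sf that, of 2] l0[OF sl(1) k(2) that]
    by (simp add: B_def p_def f_def)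
  have D1A: "?D1 A y = lam * p y" if "y \<noteq> 0" for y
    using lie_alg_commutators(3)[OF sf that, of 1] l0[OF sl(1) k(1) that] k4[OF that]
    by (simp add: A_def)
  have D2A: "?D2 A y = - ?D3 p y" if "y \<noteq> 0" for y
    using lie_alg_commutators(2)[OF sf that, of 1] k(1)[OF that] lc[OF sl(1) k4 sp sp that]
    by (simp add: A_def)
  have D1B: "?D1 B y = ?D3 p y" if "y \<noteq> 0" for y
    using lie_alg_commutators(3)[OF sf that, of 2] k(2)[OF that]
    by (simp add: B_def p_def f_def)
  \<comment> \<open>The commutator of \<open>?D1\<close> and \<open>?D2\<close> on
    \<open>f 3\<close> equals \<open>- 2 * ?D3 p y\<close> by the relations so far, and it vanishes
    because \<open>?D3 (f 3)\<close> does.\<close>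
  have D3p: "?D3 p y = 0" if "y \<noteq> 0" for y
    using lie_alg_commutators(1)[OF sf that, of 3] k(1-3)[OF that] D2A[OF that] D1B[OF that]
      lc[OF sl(1) k5 sf sA that] lc[OF sl(1) k6 sf sB that]
    by simp
  have D3B: "?D3 B x = lam * (\<sigma> * f 2 x - A x) - \<sigma> * A x"
    using lie_alg_commutators(2)[OF sf x, of 3] k5[OF x] l0[OF sl(1) k(3) x] lc[OF sl(1) k6 sf sB x]
    by (simp add: A_def)
  have D3A: "?D3 A x = \<sigma> * B x + lam * (\<sigma> * f 1 x + B x)"
    using lie_alg_commutators(3)[OF sf x, of 3] k6[OF x] l0[OF sl(1) k(3) x] lc[OF sl(1) k5 sf sA x]
    by (simp add: B_def algebra_simps)
  have D1p': "?D1 p y = (- \<tau>) * A y + 0 * A y" and D2p': "?D2 p y = (- \<tau>) * B y + 0 * B y" if "y \<noteq> 0" for y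
    using D1p D2p that by simp_all
  \<comment> \<open>The commutator of \<open>?D2\<close> and \<open>?D3\<close> on \<open>p\<close>
    gives a second value of \<open>?D3 B x\<close>. Comparison with \<open>D3B\<close> leaves an
    equation for \<open>A x\<close> with factor \<open>\<sigma>\<close>, which is nonzero because
    \<open>lam \<noteq> \<tau>\<close>; \<open>B x\<close> is found in the same way.\<close>
  have "\<tau> * ?D3 B x = \<tau> * (- lam * A x)"
    using lie_alg_commutators(2)[OF sp x] D1p[OF x] l0[OF sl(2) D3p x] lc[OF sl(2) D2p' sB sB x]
    by (simp add: algebra_simps)
  then have "?D3 B x = - lam * A x" using tau_pos by (metis mult_cancel_left less_irrefl)
  then have "\<sigma> * A x = \<sigma> * (lam * f 2 x)"
    unfolding D3B by algebra
  then have A: "A x = lam * f 2 x" using \<sigma> by (metis mult_cancel_left)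
  have "\<tau> * ?D3 A x = \<tau> * (lam * B x)"
    using lie_alg_commutators(3)[OF sp x] D2p[OF x] l0[OF sl(2) D3p x] lc[OF sl(2) D1p' sA sA x]
    by (simp add: algebra_simps)
  then have "?D3 A x = lam * B x" using tau_pos by (metis mult_cancel_left less_irrefl)
  then have "\<sigma> * B x = \<sigma> * (- lam * f 1 x)"
    unfolding D3A by algebra
  then have B: "B x = - lam * f 1 x" using \<sigma> by (metis mult_cancel_left)
  show "lie (alg 0 0 1) (f 1) x = lam * f 2 x" "lie (alg 0 0 1) (f 2) x = - lam * f 1 x"
    "lie (alg 1 0 0) p x = - \<tau> * lam * f 2 x" "lie (alg 0 1 0) p x = \<tau> * lam * f 1 x" "lie (alg 0 0 1) p x = 0"
    using A B D1p[OF x] D2p[OF x] D3p[OF x] by (simp_all add: A_def B_def)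
qed

lemma lie_along_curve:
  assumes F: "smooth_on (- {0}) F" and \<gamma>: "\<gamma> t \<in> S3"
    and d: "(\<gamma> has_vector_derivative \<gamma> t \<odot> alg a b c) (at t)"
  shows "((\<lambda>s. F (\<gamma> s)) has_real_derivative
     a * lie (alg 1 0 0) F (\<gamma> t) + b * lie (alg 0 1 0) F (\<gamma> t) + c * lie (alg 0 0 1) F (\<gamma> t)) (at t)"
proof -
  have x: "\<gamma> t \<noteq> 0" using \<gamma> by auto
  let ?D = "frechet_derivative F (at (\<gamma> t))"
  have D: "(F has_derivative ?D) (at (\<gamma> t))"
    using x by (intro smooth_on_imp_has_derivative[OF F open_punctured]) auto
  have "((\<lambda>s. F (\<gamma> s)) has_real_derivative lie (alg a b c) F (\<gamma> t)) (at t)"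
    using vector_derivative_diff_chain_within[of \<gamma> _ t UNIV F, OF d has_derivative_at_withinI[OF D]]
    by (simp add: has_real_derivative_iff_has_vector_derivative comp_def lie_def)
  then show ?thesis unfolding lie_alg[OF F x, of a b c] .
qed

end


section \<open>Geodesics and Jacobi fields\<close>

text \<open>The pair \<open>(w * y, z)\<close> turns with angular speed \<open>w\<close>; its two
  coordinates in a frame turning along with it are constant.\<close>

lemma harmonic_oscillator:
  fixes y z :: "real \<Rightarrow> real"
  assumes y: "\<And>t. (y has_real_derivative z t) (at t)"
    and z: "\<And>t. (z has_real_derivative - w\<^sup>2 * y t) (at t)"
  shows "w * y t = w * y 0 * cos (w * t) + z 0 * sin (w * t)"
proof -
  have "((\<lambda>t. w * y t * cos (w * t) - z t * sin (w * t)) has_real_derivative 0) (at t)" for t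
    by (auto intro!: derivative_eq_intros y z simp: algebra_simps power2_eq_square)
  then have A: "w * y t * cos (w * t) - z t * sin (w * t) = w * y 0" for t
    using DERIV_isconst_all[of "\<lambda>t. w * y t * cos (w * t) - z t * sin (w * t)" t 0] by simp
  have "((\<lambda>t. w * y t * sin (w * t) + z t * cos (w * t)) has_real_derivative 0) (at t)" for t
    by (auto intro!: derivative_eq_intros y z simp: algebra_simps power2_eq_square)
  then have B: "w * y t * sin (w * t) + z t * cos (w * t) = z 0" for t
    using DERIV_isconst_all[of "\<lambda>t. w * y t * sin (w * t) + z t * cos (w * t)" t 0] by simp
  have "w * y 0 * cos (w * t) + z 0 * sin (w * t) = w * y t * ((sin (w * t))\<^sup>2 + (cos (w * t))\<^sup>2)"
    unfolding A[of t, symmetric] B[of t, symmetric] by algebra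
  then show ?thesis by simp
qed

text \<open>The function equals \<open>B\<close> at \<open>pi / 2\<close> and \<open>- B\<close> at
  \<open>3 * pi / 2\<close>, so it has a root in between. If sine or cosine vanished there, the
  equation would make both vanish.\<close>

lemma tan_linear_root:
  fixes A B :: real
  assumes "A \<noteq> 0" "B > 0"
  obtains s where "s > 0" "A * s * cos s + B * sin s = 0" "sin s \<noteq> 0" "cos s \<noteq> 0"
proof -
  have s3: "sin (3 * pi / 2) = - 1" "cos (3 * pi / 2) = 0"
  proof -
    have "3 * pi / 2 = pi / 2 + pi" by simp
    then show "sin (3 * pi / 2) = - 1" "cos (3 * pi / 2) = 0"
      by (simp_all only: sin_periodic_pi cos_periodic_pi) simp_all
  qed
  have "\<exists>s\<ge>pi / 2. s \<le> 3 * pi / 2 \<and> A * s * cos s + B * sin s = 0"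
  proof (rule IVT2)
    show "A * (3 * pi / 2) * cos (3 * pi / 2) + B * sin (3 * pi / 2) \<le> 0" using assms by (simp only: s3)
    show "0 \<le> A * (pi / 2) * cos (pi / 2) + B * sin (pi / 2)" using assms by simp
    show "\<forall>s. pi / 2 \<le> s \<and> s \<le> 3 * pi / 2 \<longrightarrow> isCont (\<lambda>s. A * s * cos s + B * sin s) s"
      by (auto intro!: continuous_intros)
  qed auto
  then obtain s where s: "s \<ge> pi / 2" "A * s * cos s + B * sin s = 0" by blast
  have "s > 0" using s(1) pi_gt_zero by linarith
  moreover have "cos s \<noteq> 0"
  proof
    assume "cos s = 0"
    then have "sin s = 0" using s(2) assms by simp
    with \<open>cos s = 0\<close> show False using sin_zero_abs_cos_one by fastforce
  qed
  moreover from this have "sin s \<noteq> 0" using s(2) assms(1) \<open>s > 0\<close> by auto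
  ultimately show ?thesis using that s(2) by blast
qed

lemma has_derivative_imp_has_vector_derivative:
  assumes "(f has_derivative D) (at t)"
  shows "(f has_vector_derivative D 1) (at t)"
proof -
  have "(\<lambda>h. h *\<^sub>R D 1) = D"
  proof
    fix h
    have "D (h *\<^sub>R 1) = h *\<^sub>R D 1" by (rule linear_scale[OF has_derivative_linear[OF assms]])
    then show "h *\<^sub>R D 1 = D h" by simp
  qed
  with assms show ?thesis by (simp only: has_vector_derivative_def)
qed

context berger
begin

lemma qmult_alg_eq_0_iff:
  assumes "x \<in> S3"
  shows "x \<odot> alg a b c = 0 \<longleftrightarrow> a = 0 \<and> b = 0 \<and> c = 0"
proof -
  have "x \<odot> alg a b c = 0 \<longleftrightarrow> alg a b c = alg 0 0 0"
    using qconj_qmult_cancel(1)[OF assms, of "alg a b c"]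
    by (metis alg_zero qmult_distrib(3) scaleR_zero_left)
  then show ?thesis by (simp add: alg_eq_iff)
qed

text \<open>In frame coordinates the connection terms cancel in the third geodesic equation, so
  \<open>c\<close> is constant; the other two then say that \<open>(a, b)\<close> rotates with speed
  \<open>(lam - \<tau>) * c\<close>.\<close>

lemma geodesic_velocity:
  assumes "geodesic \<kappa> \<tau> \<gamma>"
  obtains a b c where
    "\<And>t. (\<gamma> has_vector_derivative \<gamma> t \<odot> alg (a t) (b t) c) (at t)"
    "smooth_on UNIV a" "smooth_on UNIV b"
    "\<And>t. (a has_real_derivative (lam - \<tau>) * b t * c) (at t)"
    "\<And>t. (b has_real_derivative - (lam - \<tau>) * a t * c) (at t)"
proof -
  have sm: "smooth_on UNIV \<gamma>" and "range \<gamma> \<subseteq> S3"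
    using assms by (auto simp only: geodesic_def smooth_curve_def)
  then have S: "\<gamma> t \<in> S3" for t by blast
  have D: "(\<gamma> has_derivative frechet_derivative \<gamma> (at t)) (at t)" for t
    by (rule smooth_on_imp_has_derivative[OF sm]) auto
  have vel: "velocity \<gamma> t = frechet_derivative \<gamma> (at t) 1" for t
    unfolding velocity_def by (rule vector_derivative_at[OF has_derivative_imp_has_vector_derivative[OF D]])
  have dv: "(\<gamma> has_vector_derivative velocity \<gamma> t) (at t)" for t
    using has_derivative_imp_has_vector_derivative[OF D[of t]] by (simp add: vel)
  have sv: "smooth_on UNIV (velocity \<gamma>)"
    using smooth_on_frechet_derivative[OF sm, of 1] by (simp add: vel[abs_def])
  have tan: "velocity \<gamma> t \<in> tangent (\<gamma> t)" for t
  proof -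
    \<comment> \<open>Tangency follows by differentiating the constant squared length of
      \<open>\<gamma>\<close>.\<close>
    have "((\<lambda>t. \<gamma> t \<bullet> \<gamma> t) has_derivative (\<lambda>h. \<gamma> t \<bullet> (h *\<^sub>R velocity \<gamma> t) + (h *\<^sub>R velocity \<gamma> t) \<bullet> \<gamma> t)) (at t)"
      using dv[of t] unfolding has_vector_derivative_def by (intro has_derivative_inner)
    moreover have "(\<lambda>t. \<gamma> t \<bullet> \<gamma> t) = (\<lambda>t. 1)" using S unfolding S3_iff by (simp only:)
    ultimately have "(\<lambda>h. \<gamma> t \<bullet> (h *\<^sub>R velocity \<gamma> t) + (h *\<^sub>R velocity \<gamma> t) \<bullet> \<gamma> t) = (\<lambda>h. 0)"
      using has_derivative_unique[OF _ has_derivative_const] by simp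
    from fun_cong[OF this, of 1] show ?thesis by (simp add: tangent_def inner_commute)
  qed
  define f where "f n t = crd n (qconj (\<gamma> t) \<odot> velocity \<gamma> t)" for n t
  have v: "velocity \<gamma> t = \<gamma> t \<odot> alg (f 1 t) (f 2 t) (f 3 t)" for t
    unfolding f_def alg_crd[OF qconj_qmult_tangent[OF S tan]] qconj_qmult_cancel(2)[OF S] ..
  have sf: "smooth_on UNIV (f n)" for n
  proof -
    have L: "bounded_linear qconj"
      by (simp add: linear_conv_bounded_linear[symmetric] linear_iff qconj_def)
    have L': "bounded_linear (crd n)"
      unfolding berger_coord_def divide_inverse
      by (rule bounded_linear_compose[OF bounded_linear_mult_left bounded_linear_inner_left])
    show ?thesis unfolding f_def[abs_def]
      by (rule smooth_on_bounded_linear[OF open_UNIV L' smooth_on_bilinear[OF open_UNIV bounded_bilinear_qmult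
          smooth_on_bounded_linear[OF open_UNIV L sm] sv]])
  qed
  have df: "(f n has_real_derivative deriv (f n) t) (at t)" for n t
  proof -
    have "f n differentiable at t"
      using smooth_on_imp_has_derivative[OF sf[of n] open_UNIV] by (auto simp: differentiable_def)
    then show ?thesis by (simp add: DERIV_deriv_iff_real_differentiable)
  qed
  have "cov_deriv \<kappa> \<tau> \<gamma> (velocity \<gamma>) t = 0" for t using assms by (simp add: geodesic_def)
  then have eq: "deriv (f 1) t + \<tau> / 2 * f 2 t * f 3 t - (lam - \<tau> / 2) * f 3 t * f 2 t = 0
      \<and> deriv (f 2) t + (lam - \<tau> / 2) * f 3 t * f 1 t - \<tau> / 2 * f 1 t * f 3 t = 0
      \<and> deriv (f 3) t + \<tau> / 2 * (f 1 t * f 2 t - f 2 t * f 1 t) = 0" for t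
    using cov_deriv_alg[of \<gamma> "velocity \<gamma>" "f 1" "f 2" "f 3" t, OF S v v df df df]
      qmult_alg_eq_0_iff[OF S] by metis
  have df3: "(f 3 has_real_derivative 0) (at t)" for t
    by (rule DERIV_cong[OF df]) (use eq[of t] in \<open>simp add: mult.commute del: One_nat_def\<close>)
  have f3: "f 3 t = f 3 0" for t
    by (rule DERIV_isconst_all[of "f 3"]) (use df3 in blast)
  have d12: "deriv (f 1) t = (lam - \<tau>) * f 2 t * f 3 0" "deriv (f 2) t = - (lam - \<tau>) * f 1 t * f 3 0" for t
    using eq[of t] unfolding f3[of t] by argo+
  then have "(f 1 has_real_derivative (lam - \<tau>) * f 2 t * f 3 0) (at t)"
    "(f 2 has_real_derivative - (lam - \<tau>) * f 1 t * f 3 0) (at t)" for t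
    using DERIV_cong[OF df d12(1)] DERIV_cong[OF df d12(2)] by blast+
  moreover have "(\<gamma> has_vector_derivative \<gamma> t \<odot> alg (f 1 t) (f 2 t) (f 3 0)) (at t)" for t
    using dv[of t] unfolding v f3[of t] .
  ultimately show ?thesis using that sf by blast
qed

end

section \<open>Jacobi and Killing fields along a geodesic in frame coordinates\<close>

locale berger_geodesic = berger +
  fixes \<gamma> :: "real \<Rightarrow> quat" and a b :: "real \<Rightarrow> real" and c h :: real
  assumes sphere: "\<And>t. \<gamma> t \<in> S3" and smooth: "smooth_on UNIV \<gamma>" "smooth_on UNIV a" "smooth_on UNIV b"
    and d\<gamma>: "\<And>t. (\<gamma> has_vector_derivative \<gamma> t \<odot> alg (a t) (b t) c) (at t)"
    and da: "\<And>t. (a has_real_derivative (lam - \<tau>) * b t * c) (at t)"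
    and db: "\<And>t. (b has_real_derivative - (lam - \<tau>) * a t * c) (at t)"
    and h: "\<And>t. a t * a t + b t * b t = h"
begin

lemma velocity_eq: "velocity \<gamma> t = \<gamma> t \<odot> alg (a t) (b t) c"
  unfolding velocity_def by (rule vector_derivative_at[OF d\<gamma>])

lemma field_along_alg:
  assumes "smooth_on UNIV p" "smooth_on UNIV q" "smooth_on UNIV r"
  shows "field_along \<gamma> (\<lambda>t. \<gamma> t \<odot> alg (p t) (q t) (r t))"
proof -
  have "smooth_on UNIV (\<lambda>t. \<gamma> t \<odot> alg (p t) (q t) (r t))"
    unfolding alg_def
    by (intro smooth_on_bilinear[OF open_UNIV bounded_bilinear_qmult] smooth smooth_on_add[OF open_UNIV]
        smooth_on_bounded_linear[OF open_UNIV bounded_linear_scaleR_left] assms)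
  then show ?thesis
    using linv_tangent[OF sphere alg_tangent] by (simp add: field_along_def linv_def)
qed

text \<open>\<open>X\<close>, \<open>Y\<close>, \<open>Z\<close> are the coordinates in the rotating frame consisting of the horizontal part of
  the velocity, its rotation by a right angle, and \<open>u\<^sub>3\<close>; the Jacobi equation has constant coefficients there.\<close>

definition rot :: "(real \<Rightarrow> real) \<Rightarrow> (real \<Rightarrow> real) \<Rightarrow> (real \<Rightarrow> real) \<Rightarrow> real \<Rightarrow> quat" where
  "rot X Y Z t = \<gamma> t \<odot> alg (X t * a t - Y t * b t) (X t * b t + Y t * a t) (Z t)"

text \<open>The rotation of \<open>(a, b)\<close> cancels \<open>lam\<close> from the connection
  terms, which leaves constant coefficients in \<tau>, \<open>c\<close> and
  \<open>h\<close>.\<close>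

lemma cov_deriv_rot:
  assumes "(X has_real_derivative X') (at t)" "(Y has_real_derivative Y') (at t)" "(Z has_real_derivative Z') (at t)"
  shows "cov_deriv \<kappa> \<tau> \<gamma> (rot X Y Z) t = rot (\<lambda>_. X' - \<tau> / 2 * c * Y t)
    (\<lambda>_. Y' + \<tau> / 2 * (c * X t - Z t)) (\<lambda>_. Z' + \<tau> / 2 * h * Y t) t"
proof -
  have p: "((\<lambda>t. X t * a t - Y t * b t) has_real_derivative
      X' * a t + (lam - \<tau>) * b t * c * X t - (Y' * b t + - (lam - \<tau>) * a t * c * Y t)) (at t)"
    by (intro DERIV_diff DERIV_mult assms da db)
  have q: "((\<lambda>t. X t * b t + Y t * a t) has_real_derivative
      X' * b t + - (lam - \<tau>) * a t * c * X t + (Y' * a t + (lam - \<tau>) * b t * c * Y t)) (at t)"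
    by (intro DERIV_add DERIV_mult assms da db)
  show ?thesis
    unfolding cov_deriv_alg[OF sphere rot_def[of X Y Z] velocity_eq p q assms(3)] unfolding rot_def h[of t, symmetric]
    by (intro arg_cong[where f = "(\<odot>) (\<gamma> t)"] alg_eqI) (simp_all add: field_simps)
qed

text \<open>The assumptions on \<open>X'\<close>, \<open>Y'\<close>, \<open>Z'\<close> are the
  Jacobi equation in the rotating frame. The equations for \<open>X\<close> and \<open>Z\<close> can
  be integrated once, which leaves an oscillator equation for \<open>Y\<close>.\<close>

lemma jacobi_field_rot:
  assumes sm: "smooth_on UNIV X" "smooth_on UNIV Y" "smooth_on UNIV Z"
    and d: "\<And>t. (X has_real_derivative X' t) (at t)" "\<And>t. (Y has_real_derivative Y' t) (at t)"
      "\<And>t. (Z has_real_derivative Z' t) (at t)"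
    and d': "\<And>t. (X' has_real_derivative \<tau> * c * Y' t) (at t)"
      "\<And>t. (Y' has_real_derivative \<tau> * (Z' t - c * X' t) - (\<kappa> - \<tau>\<^sup>2) * h * Y t) (at t)"
      "\<And>t. (Z' has_real_derivative - \<tau> * h * Y' t) (at t)"
  shows "jacobi_field \<kappa> \<tau> \<gamma> (rot X Y Z)"
proof -
  have f: "field_along \<gamma> (rot X Y Z)"
    unfolding rot_def[abs_def] diff_conv_add_uminus
    by (intro field_along_alg smooth_on_add smooth_on_bilinear[OF _ bounded_bilinear_mult]
        smooth_on_bounded_linear[OF _ bounded_linear_minus[OF bounded_linear_ident]] sm smooth open_UNIV)
  let ?P = "\<lambda>t. X' t - \<tau> / 2 * c * Y t" and ?Q = "\<lambda>t. Y' t + \<tau> / 2 * (c * X t - Z t)"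
    and ?S = "\<lambda>t. Z' t + \<tau> / 2 * h * Y t"
  have 1: "cov_deriv \<kappa> \<tau> \<gamma> (rot X Y Z) = rot ?P ?Q ?S"
    by (rule ext) (simp add: cov_deriv_rot[OF d] rot_def)
  have dP: "(?P has_real_derivative \<tau> * c * Y' t - \<tau> / 2 * c * Y' t) (at t)"
    and dQ: "(?Q has_real_derivative \<tau> * (Z' t - c * X' t) - (\<kappa> - \<tau>\<^sup>2) * h * Y t + \<tau> / 2 * (c * X' t - Z' t)) (at t)"
    and dS: "(?S has_real_derivative - \<tau> * h * Y' t + \<tau> / 2 * h * Y' t) (at t)" for t
    by (intro DERIV_add DERIV_diff DERIV_cmult d d')+
  have "cov_deriv \<kappa> \<tau> \<gamma> (cov_deriv \<kappa> \<tau> \<gamma> (rot X Y Z)) t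
      + curvature \<kappa> \<tau> (\<gamma> t) (rot X Y Z t) (velocity \<gamma> t) (velocity \<gamma> t) = 0" for t
  proof -
    let ?a = "a t" and ?b = "b t"
    \<comment> \<open>\<open>P2\<close>, \<open>Q2\<close> and \<open>S2\<close> compute the second
      covariant derivative; their right-hand sides are the coordinates of minus the curvature
      term.\<close>
    have P2: "\<tau> * c * Y' t - \<tau> / 2 * c * Y' t - \<tau> / 2 * c * ?Q t = (\<tau> / 2)\<^sup>2 * c * (Z t - c * X t)"
      by (simp add: power2_eq_square field_simps)
    have Q2: "\<tau> * (Z' t - c * X' t) - (\<kappa> - \<tau>\<^sup>2) * h * Y t + \<tau> / 2 * (c * X' t - Z' t) + \<tau> / 2 * (c * ?P t - ?S t)
        = - ((\<tau> / 2)\<^sup>2 * c * c + (\<kappa> - 3 * (\<tau> / 2)\<^sup>2) * h) * Y t"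
      by (simp add: power2_eq_square field_simps)
    have S2: "- \<tau> * h * Y' t + \<tau> / 2 * h * Y' t + \<tau> / 2 * h * ?Q t = - (\<tau> / 2)\<^sup>2 * h * (Z t - c * X t)"
      by (simp add: power2_eq_square field_simps)
    show ?thesis
      unfolding 1 cov_deriv_rot[OF dP dQ dS] P2 Q2 S2
      unfolding rot_def velocity_eq curvature_alg[OF sphere] qmult_distrib(1)[symmetric] alg_linear
        qmult_alg_eq_0_iff[OF sphere] h[of t, symmetric]
      by (intro conjI) (simp_all add: power2_eq_square field_simps)
  qed
  with f show ?thesis by (simp add: jacobi_field_def)
qed

text \<open>Along a fibre the horizontal field with coordinates \<open>cos (\<theta> * t)\<close>,
  \<open>- sin (\<theta> * t)\<close> is parallel, and the curvature term multiplies it by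
  \<open>(\<tau> / 2 * c)\<^sup>2\<close>; so the scalar factor has to solve an oscillator
  equation.\<close>

lemma jacobi_field_vertical:
  assumes v: "h = 0"
  defines "\<theta> \<equiv> (lam - \<tau> / 2) * c"
  shows "jacobi_field \<kappa> \<tau> \<gamma>
    (\<lambda>t. \<gamma> t \<odot> alg (sin (\<tau> / 2 * c * t) * cos (\<theta> * t)) (- sin (\<tau> / 2 * c * t) * sin (\<theta> * t)) 0)"
proof -
  have ab: "a t = 0" "b t = 0" for t using h[of t] v by (simp_all add: sum_squares_eq_zero_iff)
  have D: "cov_deriv \<kappa> \<tau> \<gamma> (\<lambda>t. \<gamma> t \<odot> alg (f t * cos (\<theta> * t)) (- f t * sin (\<theta> * t)) 0)
      = (\<lambda>t. \<gamma> t \<odot> alg (f' t * cos (\<theta> * t)) (- f' t * sin (\<theta> * t)) 0)"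
    if f: "\<And>t. (f has_real_derivative f' t) (at t)" for f f' :: "real \<Rightarrow> real"
  proof
    fix t
    have p: "((\<lambda>t. f t * cos (\<theta> * t)) has_real_derivative f' t * cos (\<theta> * t) - f t * sin (\<theta> * t) * \<theta>) (at t)"
      by (auto intro!: derivative_eq_intros f simp: algebra_simps)
    have q: "((\<lambda>t. - f t * sin (\<theta> * t)) has_real_derivative - f' t * sin (\<theta> * t) - f t * cos (\<theta> * t) * \<theta>) (at t)"
      by (auto intro!: derivative_eq_intros f simp: algebra_simps)
    show "cov_deriv \<kappa> \<tau> \<gamma> (\<lambda>t. \<gamma> t \<odot> alg (f t * cos (\<theta> * t)) (- f t * sin (\<theta> * t)) 0) t
      = \<gamma> t \<odot> alg (f' t * cos (\<theta> * t)) (- f' t * sin (\<theta> * t)) 0"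
      unfolding cov_deriv_alg[OF sphere refl velocity_eq p q DERIV_const] ab
      by (intro arg_cong[where f = "(\<odot>) (\<gamma> t)"] alg_eqI) (simp_all add: \<theta>_def algebra_simps)
  qed
  have d1: "((\<lambda>t. sin (\<tau> / 2 * c * t)) has_real_derivative \<tau> / 2 * c * cos (\<tau> / 2 * c * t)) (at t)"
    and d2: "((\<lambda>t. \<tau> / 2 * c * cos (\<tau> / 2 * c * t)) has_real_derivative - (\<tau> / 2 * c)\<^sup>2 * sin (\<tau> / 2 * c * t)) (at t)" for t
    by (auto intro!: derivative_eq_intros simp: power2_eq_square)
  have sc: "smooth_on UNIV (\<lambda>t. sin (k * t))" "smooth_on UNIV (\<lambda>t. cos (k * t))" for k :: real
    using smooth_on_sin_cos[of k 0] by simp_all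
  show ?thesis
    unfolding jacobi_field_def D[OF d1] D[OF d2] velocity_eq curvature_alg[OF sphere] ab
      qmult_distrib(1)[symmetric] alg_linear qmult_alg_eq_0_iff[OF sphere]
    by (intro conjI allI field_along_alg smooth_on_bilinear[OF open_UNIV bounded_bilinear_mult]
        smooth_on_bounded_linear[OF open_UNIV bounded_linear_minus[OF bounded_linear_ident]] sc smooth_on_const)
      (simp_all add: power2_eq_square algebra_simps)
qed

lemma killing_along:
  assumes K: "killing_field \<kappa> \<tau> X" and ne: "lam \<noteq> \<tau>" and X0: "X (\<gamma> 0) = 0"
    and t0: "h \<noteq> 0 \<Longrightarrow> X (\<gamma> t0) = 0 \<and> sin (sqrt (\<kappa> * h + \<tau>\<^sup>2 * c\<^sup>2) * t0) \<noteq> 0"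
  shows "X (\<gamma> t) = 0"
proof -
  have vX: "vector_field X" using K by (simp add: killing_field_def)
  define f where "f n t = component X n (\<gamma> t)" for n t
  define p where "p t = lie (alg 1 0 0) (component X 2) (\<gamma> t)" for t
  have x: "\<gamma> t \<noteq> 0" for t using sphere[of t] by auto
  have X_eq: "X (\<gamma> t) = \<gamma> t \<odot> alg (f 1 t) (f 2 t) (f 3 t)" for t
    unfolding f_def by (rule vector_field_components[OF vX sphere])
  have X_0: "X (\<gamma> t) = 0 \<longleftrightarrow> f 1 t = 0 \<and> f 2 t = 0 \<and> f 3 t = 0" for t
    unfolding X_eq by (rule qmult_alg_eq_0_iff[OF sphere])
  note sm = component_smooth[OF vX]
  note E = killing_equation[OF K x] killing_system[OF K ne x]
  have df: "(f 1 has_real_derivative - b t * p t + c * lam * f 2 t) (at t)"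
    "(f 2 has_real_derivative a t * p t - c * lam * f 1 t) (at t)"
    "(f 3 has_real_derivative \<tau> * (b t * f 1 t - a t * f 2 t)) (at t)" for t
    using lie_along_curve[where F = "component X 1" and \<gamma> = \<gamma> and t = t, OF sm sphere d\<gamma>]
      lie_along_curve[where F = "component X 2" and \<gamma> = \<gamma> and t = t, OF sm sphere d\<gamma>]
      lie_along_curve[where F = "component X 3" and \<gamma> = \<gamma> and t = t, OF sm sphere d\<gamma>]
    unfolding E unfolding f_def[symmetric] p_def[symmetric]
    by (auto elim!: DERIV_cong simp: algebra_simps)
  have dp: "(p has_real_derivative - \<kappa> * (a t * f 2 t - b t * f 1 t)) (at t)" for t
  proof -
    have "a t * (- \<tau> * lam * f 2 t) + b t * (\<tau> * lam * f 1 t) + c * 0 = - (lam * \<tau>) * (a t * f 2 t - b t * f 1 t)"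
      by (simp add: algebra_simps)
    then show ?thesis
      using lie_along_curve[where F = "lie (alg 1 0 0) (component X 2)" and \<gamma> = \<gamma> and t = t, OF smooth_on_lie[OF sm] sphere d\<gamma>]
      unfolding E unfolding f_def[symmetric] p_def[symmetric] kap_eq[symmetric] by simp
  qed
  have f0: "f 1 0 = 0" "f 2 0 = 0" "f 3 0 = 0" using X0 X_0 by auto
  show ?thesis
  proof (cases "h = 0")
    case True
    then have ab: "a t = 0" "b t = 0" for t using h[of t] by (simp_all add: sum_squares_eq_zero_iff)
    \<comment> \<open>On a fibre the horizontal part only rotates, so its length stays at its
      initial value 0.\<close>
    have "((\<lambda>t. f 1 t * f 1 t + f 2 t * f 2 t) has_real_derivative 0) (at t)" for t
      by (rule DERIV_cong[OF DERIV_add[OF DERIV_mult[OF df(1) df(1)] DERIV_mult[OF df(2) df(2)]]])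
        (simp add: ab algebra_simps)
    then have "f 1 t * f 1 t + f 2 t * f 2 t = f 1 0 * f 1 0 + f 2 0 * f 2 0"
      by (intro DERIV_isconst_all[of "\<lambda>t. f 1 t * f 1 t + f 2 t * f 2 t"]) blast
    then have "f 1 t = 0 \<and> f 2 t = 0" by (simp add: f0[unfolded One_nat_def] sum_squares_eq_zero_iff)
    moreover have "f 3 t = f 3 0" using df(3) by (intro DERIV_isconst_all[of "f 3"]) (simp add: ab)
    ultimately show ?thesis using X_0 f0 by simp
  next
    case False
    have "h > 0" using False h[of 0] sum_squares_ge_zero[of "a 0" "b 0"] by linarith
    define w where "w = sqrt (\<kappa> * h + \<tau>\<^sup>2 * c\<^sup>2)"
    have pos: "\<kappa> * h + \<tau>\<^sup>2 * c\<^sup>2 > 0" using \<open>h > 0\<close> kap_pos by (simp add: add_pos_nonneg)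
    have w: "w\<^sup>2 = \<kappa> * h + \<tau>\<^sup>2 * c\<^sup>2" "w > 0" using pos by (simp_all add: w_def)
    \<comment> \<open>Up to the factor \<open>sqrt h\<close>, \<open>u\<close> and \<open>y\<close>
      are the parts of the field along the horizontal velocity and along its rotation by a right
      angle.\<close>
    define y where "y t = a t * f 2 t - b t * f 1 t" for t
    define u where "u t = a t * f 1 t + b t * f 2 t" for t
    have du: "(u has_real_derivative \<tau> * c * y t) (at t)" for t
      unfolding u_def[abs_def] y_def
      by (rule DERIV_cong[OF DERIV_add[OF DERIV_mult[OF da df(1)] DERIV_mult[OF db df(2)]]]) (simp add: algebra_simps)
    have dy: "(y has_real_derivative h * p t - \<tau> * c * u t) (at t)" for t
      unfolding u_def y_def[abs_def] h[of t, symmetric]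
      by (rule DERIV_cong[OF DERIV_diff[OF DERIV_mult[OF da df(2)] DERIV_mult[OF db df(1)]]]) (simp add: algebra_simps)
    \<comment> \<open>The differentiated function is the derivative of \<open>y\<close>, so
      \<open>y\<close> is an oscillator of frequency \<open>w\<close>. With zero initial value its
      amplitude is governed by \<open>p 0\<close>, and the zero at \<open>t0\<close> forces
      \<open>p 0 = 0\<close>.\<close>
    have dz: "((\<lambda>t. h * p t - \<tau> * c * u t) has_real_derivative - w\<^sup>2 * y t) (at t)" for t
      by (rule DERIV_cong[OF DERIV_diff[OF DERIV_cmult[OF dp] DERIV_cmult[OF du]]])
        (simp only: y_def[symmetric] w(1), simp add: algebra_simps power2_eq_square)
    have y: "w * y t = h * p 0 * sin (w * t)" for t
      using harmonic_oscillator[OF dy dz, of t] by (simp add: y_def u_def f0[unfolded One_nat_def])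
    have "y t0 = 0" "sin (w * t0) \<noteq> 0" using t0[OF False] X_0[of t0] by (simp_all add: y_def w_def)
    with y[of t0] have p0: "p 0 = 0" using False by simp
    have y0: "y t = 0" for t using y[of t] w(2) p0 by simp
    have u0: "u t = 0"
    proof -
      have "u t = u 0" using du y0 by (intro DERIV_isconst_all[of u]) simp
      then show ?thesis by (simp add: u_def f0[unfolded One_nat_def])
    qed
    have "f 3 t = f 3 0"
    proof (intro DERIV_isconst_all[of "f 3"] allI)
      fix t show "(f 3 has_real_derivative 0) (at t)" using df(3)[of t] y0[of t]
        by (simp add: y_def algebra_simps)
    qed
    moreover have "h * f 1 t = a t * u t - b t * y t" "h * f 2 t = b t * u t + a t * y t"
      unfolding h[of t, symmetric] u_def y_def by (simp_all add: algebra_simps)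
    ultimately show ?thesis using X_0 y0 u0 f0 False by simp
  qed
qed

end


section \<open>A conjugate point that is not isotropic\<close>

context berger_geodesic
begin

text \<open>The factor \<open>sin (k * t)\<close> vanishes at 0 and at \<open>pi / k\<close>. This
  parameter is negative when \<open>c\<close> is, which \<open>conjugate_at\<close> admits.\<close>

lemma vertical_conjugate:
  assumes h0: "h = 0" and c: "c \<noteq> 0"
  shows "conjugate_at \<kappa> \<tau> \<gamma> (pi / (\<tau> / 2 * c))"
proof -
  define k where "k = \<tau> / 2 * c"
  define \<theta> where "\<theta> = (lam - \<tau> / 2) * c"
  define J where "J t = \<gamma> t \<odot> alg (sin (k * t) * cos (\<theta> * t)) (- sin (k * t) * sin (\<theta> * t)) 0" for t
  have k: "k \<noteq> 0" using c tau_pos by (simp add: k_def)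
  have J: "jacobi_field \<kappa> \<tau> \<gamma> J"
    using jacobi_field_vertical[OF h0] unfolding J_def[abs_def] k_def \<theta>_def .
  have J0: "J t = 0 \<longleftrightarrow> sin (k * t) * cos (\<theta> * t) = 0 \<and> sin (k * t) * sin (\<theta> * t) = 0" for t
    unfolding J_def qmult_alg_eq_0_iff[OF sphere] by simp
  have "J 0 = 0" "J (pi / k) = 0" using k by (simp_all add: J0)
  \<comment> \<open>Here the sine factor is 1, and the parallel field it multiplies has unit
    length.\<close>
  moreover have "J (pi / 2 / k) \<noteq> 0"
  proof
    assume "J (pi / 2 / k) = 0"
    moreover have "k * (pi / 2 / k) = pi / 2" using k by simp
    ultimately have "cos (\<theta> * (pi / 2 / k)) = 0" "sin (\<theta> * (pi / 2 / k)) = 0"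
      unfolding J0 by (simp_all only: sin_pi_half) simp_all
    then show False using sin_cos_squared_add[of "\<theta> * (pi / 2 / k)"] by simp
  qed
  ultimately show ?thesis
    using J k unfolding conjugate_at_def k_def[symmetric] by auto
qed

lemma nonvertical_conjugate:
  assumes hpos: "h > 0" and ne: "\<kappa> \<noteq> \<tau>\<^sup>2"
  obtains t where "conjugate_at \<kappa> \<tau> \<gamma> t" "sin (sqrt (\<kappa> * h + \<tau>\<^sup>2 * c\<^sup>2) * t) \<noteq> 0"
proof -
  define w where "w = sqrt (\<kappa> * h + \<tau>\<^sup>2 * c\<^sup>2)"
  have pos: "\<kappa> * h + \<tau>\<^sup>2 * c\<^sup>2 > 0" using hpos kap_pos by (simp add: add_pos_nonneg)
  have w2: "w * w = \<kappa> * h + \<tau>\<^sup>2 * c\<^sup>2" and w: "w > 0" using pos by (simp_all add: w_def)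
  \<comment> \<open>The coefficients \<open>A\<close> and \<open>B\<close> of
    \<open>tan_linear_root\<close>; \<open>\<kappa> \<noteq> \<tau>\<^sup>2\<close> makes the first
    one nonzero.\<close>
  have "(\<kappa> - \<tau>\<^sup>2) * h \<noteq> 0" "\<tau>\<^sup>2 * (h + c\<^sup>2) > 0"
    using hpos ne tau_pos by (simp_all add: add_pos_nonneg)
  then obtain s where s: "s > 0" "(\<kappa> - \<tau>\<^sup>2) * h * s * cos s + \<tau>\<^sup>2 * (h + c\<^sup>2) * sin s = 0"
      "sin s \<noteq> 0" "cos s \<noteq> 0"
    by (rule tan_linear_root)
  \<comment> \<open>\<open>Z - c X\<close> and \<open>Y\<close> solve the normal part of the Jacobi equation and vanish at \<open>0\<close>; the equation for
    \<open>s\<close> says that they vanish at \<open>t0\<close>.  The tangential term \<open>e t (1, 0, c)\<close> then makes \<open>X t0 = 0\<close>.\<close>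
  define t0 where "t0 = 2 * s / w"
  have t0: "t0 > 0" "w * t0 = 2 * s" using s w by (simp_all add: t0_def)
  define C where "C = cos s"
  \<comment> \<open>Symmetric about \<open>s / w\<close>, hence zero both at 0 and at
    \<open>t0\<close>; \<open>I\<close> is its primitive with \<open>I 0 = 0\<close>.\<close>
  define Y where "Y t = C - cos (w * t - s)" for t
  define I where "I t = C * t - (sin (w * t - s) + sin s) / w" for t
  define e where "e = - \<tau> * c * I t0 / t0"
  define X where "X t = \<tau> * c * I t + e * t" for t
  \<comment> \<open>The linear coefficient is forced by the equation for \<open>Y'\<close>, whose
    right-hand side must become \<open>w * w * (C - Y t)\<close>.\<close>
  define Z where "Z t = w * w * C / \<tau> * t - \<tau> * (h + c\<^sup>2) * I t + c * X t" for t
  define Y' where "Y' t = w * sin (w * t - s)" for t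
  define X' where "X' t = \<tau> * c * Y t + e" for t
  define Z' where "Z' t = w * w * C / \<tau> - \<tau> * (h + c\<^sup>2) * Y t + c * X' t" for t
  have dY: "(Y has_real_derivative Y' t) (at t)" for t
    unfolding Y_def[abs_def] Y'_def by (auto intro!: derivative_eq_intros)
  have dI: "(I has_real_derivative Y t) (at t)" for t
    unfolding I_def[abs_def] Y_def using w by (auto intro!: derivative_eq_intros simp: field_simps)
  have dX: "(X has_real_derivative X' t) (at t)" for t
    unfolding X_def[abs_def] X'_def by (auto intro!: derivative_eq_intros dI)
  have dZ: "(Z has_real_derivative Z' t) (at t)" for t
    unfolding Z_def[abs_def] Z'_def using tau_pos by (auto intro!: derivative_eq_intros dI dX)
  have dX': "(X' has_real_derivative \<tau> * c * Y' t) (at t)" for t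
    unfolding X'_def[abs_def] by (auto intro!: derivative_eq_intros dY)
  have dZ': "(Z' has_real_derivative - \<tau> * h * Y' t) (at t)" for t
    unfolding Z'_def[abs_def]
    by (auto intro!: derivative_eq_intros dY dX' simp: algebra_simps power2_eq_square)
  have dY': "(Y' has_real_derivative \<tau> * (Z' t - c * X' t) - (\<kappa> - \<tau>\<^sup>2) * h * Y t) (at t)" for t
  proof -
    have "\<tau> * (Z' t - c * X' t) = w * w * C - \<tau>\<^sup>2 * (h + c\<^sup>2) * Y t"
      using tau_pos by (simp add: Z'_def field_simps power2_eq_square)
    then have "\<tau> * (Z' t - c * X' t) - (\<kappa> - \<tau>\<^sup>2) * h * Y t = w * w * C - (\<kappa> * h + \<tau>\<^sup>2 * c\<^sup>2) * Y t"
      by (simp add: algebra_simps)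
    also have "\<dots> = w * w * cos (w * t - s)"
      unfolding w2[symmetric] Y_def by (simp add: algebra_simps)
    finally show ?thesis
      unfolding Y'_def[abs_def] by (auto intro!: derivative_eq_intros)
  qed
  have smC: "smooth_on UNIV (\<lambda>t. k * t)" for k :: real
    by (rule smooth_on_bounded_linear[OF open_UNIV bounded_linear_mult_right smooth_on_id[OF open_UNIV]])
  have lin: "smooth_on UNIV (\<lambda>t. k * f t + l * g t)"
    if "smooth_on UNIV f" "smooth_on UNIV g" for k l and f g :: "real \<Rightarrow> real"
    by (intro smooth_on_add open_UNIV smooth_on_bounded_linear[OF open_UNIV bounded_linear_mult_right] that)
  have smY: "smooth_on UNIV Y"
    using lin[OF smooth_on_const[of UNIV C] smooth_on_sin_cos(2)[of w "- s"], of 1 "- 1"] by (simp add: Y_def[abs_def])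
  have smI: "smooth_on UNIV I"
    using lin[OF smC[of C] lin[OF smooth_on_sin_cos(1)[of w "- s"] smooth_on_const[of UNIV "sin s"], of 1 1], of 1 "- 1 / w"]
    by (simp add: I_def[abs_def])
  have smX: "smooth_on UNIV X"
    using lin[OF smI smC[of e], of "\<tau> * c" 1] by (simp add: X_def[abs_def])
  have smZ: "smooth_on UNIV Z"
    using lin[OF lin[OF smC[of 1] smI, of "w * w * C / \<tau>" "- \<tau> * (h + c\<^sup>2)"] smX, of 1 c] by (simp add: Z_def[abs_def])
  have J: "jacobi_field \<kappa> \<tau> \<gamma> (rot X Y Z)"
    by (rule jacobi_field_rot[OF smX smY smZ dX dY dZ dX' dY' dZ'])
  have start: "I 0 = 0" "Y 0 = 0" by (simp_all add: I_def Y_def C_def)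
  then have "rot X Y Z 0 = 0" by (simp add: rot_def X_def Z_def qmult_alg_eq_0_iff[OF sphere])
  moreover have "rot X Y Z t0 = 0"
  proof -
    have Y: "Y t0 = 0" by (simp add: Y_def t0 C_def)
    have X: "X t0 = 0" using t0 by (simp add: X_def e_def)
    have "w * I t0 = C * (w * t0) - (sin (w * t0 - s) + sin s)"
      using w by (simp add: I_def right_diff_distrib mult.left_commute)
    then have wI: "w * I t0 = 2 * (s * C - sin s)" unfolding t0(2) by simp
    \<comment> \<open>After substituting \<open>w2\<close> the right-hand side is twice the left
      side of the equation that defines \<open>s\<close>.\<close>
    have "\<tau> * w * Z t0 = w * w * C * (2 * s) - \<tau>\<^sup>2 * (h + c\<^sup>2) * (2 * (s * C - sin s))"
      unfolding t0(2)[symmetric] wI[symmetric] using tau_pos by (simp add: Z_def X field_simps power2_eq_square)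
    also have "\<dots> = 2 * ((\<kappa> - \<tau>\<^sup>2) * h * s * cos s + \<tau>\<^sup>2 * (h + c\<^sup>2) * sin s)"
      unfolding w2 C_def by (simp add: algebra_simps)
    finally have "Z t0 = 0" using s(2) tau_pos w by simp
    with X Y show ?thesis by (simp add: rot_def qmult_alg_eq_0_iff[OF sphere])
  qed
  \<comment> \<open>At this parameter \<open>Y\<close> equals \<open>cos s + 1\<close>, which is
    nonzero because \<open>sin s \<noteq> 0\<close>.\<close>
  moreover have "rot X Y Z ((s + pi) / w) \<noteq> 0" (is "rot X Y Z ?t \<noteq> 0")
  proof
    assume "rot X Y Z ?t = 0"
    then have "X ?t * a ?t - Y ?t * b ?t = 0" "X ?t * b ?t + Y ?t * a ?t = 0"
      unfolding rot_def qmult_alg_eq_0_iff[OF sphere] by auto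
    then have "Y ?t * (a ?t * a ?t + b ?t * b ?t) = 0" by algebra
    then have "Y ?t = 0" using h[of ?t] hpos by simp
    then have "cos s = - 1" using w by (simp add: Y_def C_def)
    then show False using s(3) sin_cos_squared_add[of s] by simp
  qed
  ultimately have "conjugate_at \<kappa> \<tau> \<gamma> t0"
    using J t0(1) by (auto simp: conjugate_at_def)
  moreover have "sin (w * t0) \<noteq> 0"
    using s(3,4) by (simp add: t0 sin_double)
  ultimately show ?thesis using that by (simp add: w_def)
qed

lemma not_isotropic:
  assumes "h \<noteq> 0 \<or> c \<noteq> 0" and ne: "\<kappa> \<noteq> \<tau>\<^sup>2"
  shows "\<exists>t. conjugate_at \<kappa> \<tau> \<gamma> t \<and> \<not> isotropic_at \<kappa> \<tau> \<gamma> t"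
proof -
  have hnn: "h \<ge> 0" using h[of 0] sum_squares_ge_zero[of "a 0" "b 0"] by linarith
  \<comment> \<open>The sine condition is conditional, so fibres and all other geodesics meet the
    hypothesis of \<open>killing_along\<close> in one form.\<close>
  obtain t0 where t0: "conjugate_at \<kappa> \<tau> \<gamma> t0" "h \<noteq> 0 \<Longrightarrow> sin (sqrt (\<kappa> * h + \<tau>\<^sup>2 * c\<^sup>2) * t0) \<noteq> 0"
  proof (cases "h = 0")
    case True
    then show ?thesis using that[OF vertical_conjugate] assms(1) by blast
  next
    case False
    then have "h > 0" using hnn by simp
    from nonvertical_conjugate[OF this ne] show ?thesis using that by blast
  qed
  have lam: "lam \<noteq> \<tau>"
  proof
    assume "lam = \<tau>"
    then show False using ne kap_eq[unfolded \<open>lam = \<tau>\<close>] by (simp add: power2_eq_square)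
  qed
  have "\<not> isotropic_at \<kappa> \<tau> \<gamma> t0"
  proof
    assume "isotropic_at \<kappa> \<tau> \<gamma> t0"
    then obtain J s X where J: "J s \<noteq> 0" "J 0 = 0" "J t0 = 0" "killing_field \<kappa> \<tau> X" "\<And>t. J t = X (\<gamma> t)"
      unfolding isotropic_at_def isotropic_jacobi_field_def by blast
    have X0: "X (\<gamma> 0) = 0" "X (\<gamma> t0) = 0"
      using J(2,3) J(5)[of 0] J(5)[of t0] by simp_all
    have "X (\<gamma> s) = 0"
      by (rule killing_along[OF J(4) lam X0(1)]) (use X0(2) t0(2) in blast)
    then show False using J(1) J(5)[of s] by simp
  qed
  with t0 show ?thesis by blast
qed

end

theorem mainTheorem9:
  fixes \<kappa> \<tau> :: real
  assumes "\<kappa> > 0" and "\<tau> > 0" and "\<kappa> \<noteq> \<tau>\<^sup>2"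
  shows "\<not> (\<exists>\<gamma>. isotropic_geodesic \<kappa> \<tau> \<gamma>)"
proof
  assume "\<exists>\<gamma>. isotropic_geodesic \<kappa> \<tau> \<gamma>"
  then obtain \<gamma> where geo: "geodesic \<kappa> \<tau> \<gamma>"
    and iso: "\<And>t. conjugate_at \<kappa> \<tau> \<gamma> t \<Longrightarrow> isotropic_at \<kappa> \<tau> \<gamma> t"
    unfolding isotropic_geodesic_def by blast
  interpret berger \<kappa> \<tau> using assms by unfold_locales
  obtain a b c where v:
    "\<And>t. (\<gamma> has_vector_derivative \<gamma> t \<odot> alg (a t) (b t) c) (at t)"
    "smooth_on UNIV a" "smooth_on UNIV b"
    "\<And>t. (a has_real_derivative (lam - \<tau>) * b t * c) (at t)"
    "\<And>t. (b has_real_derivative - (lam - \<tau>) * a t * c) (at t)"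
    by (rule geodesic_velocity[OF geo]) (rule that)
  define h where "h = a 0 * a 0 + b 0 * b 0"
  have dh: "((\<lambda>t. a t * a t + b t * b t) has_real_derivative 0) (at t)" for t
    by (rule DERIV_cong[OF DERIV_add[OF DERIV_mult[OF v(4,4)] DERIV_mult[OF v(5,5)]]]) (simp add: algebra_simps)
  have h: "a t * a t + b t * b t = h" for t
    unfolding h_def by (rule DERIV_isconst_all[of "\<lambda>t. a t * a t + b t * b t"]) (use dh in blast)
  have sm: "smooth_on UNIV \<gamma>" and "range \<gamma> \<subseteq> S3"
    using geo by (auto simp only: geodesic_def smooth_curve_def)
  then have S: "\<gamma> t \<in> S3" for t by blast
  interpret berger_geodesic \<kappa> \<tau> \<gamma> a b c h
    by unfold_locales (fact S sm v h)+
  \<comment> \<open>Otherwise the velocity vanishes identically and \<open>\<gamma>\<close> is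
    constant, contrary to the definition of a geodesic.\<close>
  have "h \<noteq> 0 \<or> c \<noteq> 0"
  proof (rule ccontr)
    assume "\<not> (h \<noteq> 0 \<or> c \<noteq> 0)"
    then have "a t = 0" "b t = 0" "c = 0" for t using h[of t] by (simp_all add: sum_squares_eq_zero_iff)
    then have "(\<gamma> has_vector_derivative 0) (at t)" for t
      using v(1)[of t] qmult_alg_eq_0_iff[OF sphere, of t "a t" "b t" c] by simp
    then have "(\<gamma> has_derivative (\<lambda>_. 0)) (at t within UNIV)" for t
      by (simp add: has_vector_derivative_def)
    then obtain k where "\<And>t. \<gamma> t = k"
      using has_derivative_zero_constant[of UNIV \<gamma>] by auto
    then show False using geo by (simp add: geodesic_def)
  qed
  with not_isotropic assms(3) iso show False by blast
qed

end
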